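(* Let $G$ be a group and let $\rho: G\to{\rm GL}(V)$ be any finite-dimensional representation of $G$ over a field $k$. Then the following implications hold: if $\rho$ is dense, then $\rho$ is thick; and if $\rho$ is thick, then $\rho$ is irreducible.
   Context: Let $n=\dim V$. The representation $\rho$ is $m$-thick if for any subspaces $V_1,V_2$ of $V$ with $\dim V_1=m$ and $\dim V_2=n-m$ there exists $g\in G$ such that $(\rho(g)V_1)\oplus V_2=V$; $\rho$ is thick if it is $m$-thick for each $0<m<n$. The representation $\rho$ is $m$-dense if the induced representation $\wedge^m\rho: G\to{\rm GL}(\wedge^m V)$ is irreducible; $\rho$ is dense if it is $m$-dense for each $0<m<n$. A representation is irreducible if it has no non-trivial $G$-invariant subspace, that is, no $G$-invariant subspace other than $0$ and the whole space. *)

theory Defs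
  imports
    "Jordan_Normal_Form.Missing_VectorSpace"
    "HOL-Algebra.Bij"
    "HOL-Algebra.AbelCoset"
begin

section \<open>Representations\<close>

definition GL :: "('k, 'a) ring_scheme \<Rightarrow> ('k, 'v, 'b) module_scheme \<Rightarrow> ('v \<Rightarrow> 'v) monoid" where
  "GL K V = BijGroup (carrier V) \<lparr>carrier := Bij (carrier V) \<inter> module_hom K V V\<rparr>"

definition invariant_subspace ::
  "('k, 'a) ring_scheme \<Rightarrow> ('k, 'v, 'b) module_scheme \<Rightarrow> ('g, 'c) monoid_scheme
    \<Rightarrow> ('g \<Rightarrow> 'v \<Rightarrow> 'v) \<Rightarrow> 'v set \<Rightarrow> bool" where
  "invariant_subspace K V G \<rho> W \<longleftrightarrow>
     subspace K W V \<and> (\<forall>g\<in>carrier G. \<rho> g ` W \<subseteq> W)"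

text \<open>
  Irreducibility only forbids invariant subspaces other than \<open>0\<close> and the whole space; the
  zero representation is not excluded.
\<close>

definition irreducible_rep ::
  "('k, 'a) ring_scheme \<Rightarrow> ('k, 'v, 'b) module_scheme \<Rightarrow> ('g, 'c) monoid_scheme
    \<Rightarrow> ('g \<Rightarrow> 'v \<Rightarrow> 'v) \<Rightarrow> bool" where
  "irreducible_rep K V G \<rho> \<longleftrightarrow>
     (\<forall>W. invariant_subspace K V G \<rho> W \<longrightarrow> W = {\<zero>\<^bsub>V\<^esub>} \<or> W = carrier V)"


section \<open>Exterior powers\<close>

text \<open>The ring components \<open>mult\<close> and \<open>one\<close> of a module record play no role and are filled arbitrarily.\<close>

definition quotient_space ::
  "('k, 'v, 'b) module_scheme \<Rightarrow> 'v set \<Rightarrow> ('k, 'v set) module" where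
  "quotient_space V N =
     \<lparr>carrier = a_rcosets\<^bsub>V\<^esub> N, mult = (\<lambda>_ _. N), one = N, zero = N,
      add = (\<lambda>X Y. X <+>\<^bsub>V\<^esub> Y),
      smult = (\<lambda>c X. \<Union>x\<in>X. N +>\<^bsub>V\<^esub> (c \<odot>\<^bsub>V\<^esub> x))\<rparr>"

text \<open>The free vector space on \<open>S\<close>: functions \<open>S \<rightarrow> K\<close> of finite support.\<close>

definition free_space ::
  "('k, 'a) ring_scheme \<Rightarrow> 's set \<Rightarrow> ('k, 's \<Rightarrow> 'k) module" where
  "free_space K S = (ring.func_space K S)
     \<lparr>carrier := {f \<in> S \<rightarrow>\<^sub>E carrier K. finite {s \<in> S. f s \<noteq> \<zero>\<^bsub>K\<^esub>}}\<rparr>"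

definition free_gen :: "('k, 'a) ring_scheme \<Rightarrow> 's set \<Rightarrow> 's \<Rightarrow> 's \<Rightarrow> 'k" where
  "free_gen K S s = (\<lambda>t\<in>S. if t = s then \<one>\<^bsub>K\<^esub> else \<zero>\<^bsub>K\<^esub>)"

text \<open>
  The linear extension of \<open>h : S \<rightarrow> S\<close> to the free vector space. The sum runs over the support of
  \<open>f\<close> only, because \<^const>\<open>finsum\<close> does not respect sums over infinite index sets with finite
  support.
\<close>

definition free_map ::
  "('k, 'a) ring_scheme \<Rightarrow> 's set \<Rightarrow> ('s \<Rightarrow> 's) \<Rightarrow> ('s \<Rightarrow> 'k) \<Rightarrow> 's \<Rightarrow> 'k" where
  "free_map K S h f = (\<lambda>t\<in>S. \<Oplus>\<^bsub>K\<^esub>s\<in>{s \<in> S. f s \<noteq> \<zero>\<^bsub>K\<^esub> \<and> h s = t}. f s)"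

definition tuples :: "('k, 'v, 'b) module_scheme \<Rightarrow> nat \<Rightarrow> 'v list set" where
  "tuples V m = {xs. length xs = m \<and> set xs \<subseteq> carrier V}"

text \<open>
  The exterior power \<open>\<Lambda>\<^sup>m V\<close> is the free vector space on \<open>V\<^sup>m\<close> modulo the relations making
  \<open>(v\<^sub>1, \<dots>, v\<^sub>m) \<mapsto> v\<^sub>1 \<and> \<dots> \<and> v\<^sub>m\<close> multilinear and alternating. Alternating means vanishing on
  tuples with a repeated entry, which is the correct notion in characteristic 2 as well.
\<close>

abbreviation (input) tuple_space ::
  "('k, 'a) ring_scheme \<Rightarrow> ('k, 'v, 'b) module_scheme \<Rightarrow> nat \<Rightarrow> ('k, 'v list \<Rightarrow> 'k) module" where
  "tuple_space K V m \<equiv> free_space K (tuples V m)"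

definition wedge_relations ::
  "('k, 'a) ring_scheme \<Rightarrow> ('k, 'v, 'b) module_scheme \<Rightarrow> nat \<Rightarrow> ('v list \<Rightarrow> 'k) set" where
  "wedge_relations K V m =
     (let F = tuple_space K V m; e = free_gen K (tuples V m) in
       {e (xs[i := v \<oplus>\<^bsub>V\<^esub> w]) \<ominus>\<^bsub>F\<^esub> (e (xs[i := v]) \<oplus>\<^bsub>F\<^esub> e (xs[i := w])) | xs i v w.
          xs \<in> tuples V m \<and> i < m \<and> v \<in> carrier V \<and> w \<in> carrier V} \<union>
       {e (xs[i := c \<odot>\<^bsub>V\<^esub> v]) \<ominus>\<^bsub>F\<^esub> (c \<odot>\<^bsub>F\<^esub> e (xs[i := v])) | xs i c v.
          xs \<in> tuples V m \<and> i < m \<and> c \<in> carrier K \<and> v \<in> carrier V} \<union>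
       {e xs | xs i j. xs \<in> tuples V m \<and> i < j \<and> j < m \<and> xs ! i = xs ! j})"

definition wedge_kernel ::
  "('k, 'a) ring_scheme \<Rightarrow> ('k, 'v, 'b) module_scheme \<Rightarrow> nat \<Rightarrow> ('v list \<Rightarrow> 'k) set" where
  "wedge_kernel K V m = module.span K (tuple_space K V m) (wedge_relations K V m)"

definition exterior_power ::
  "('k, 'a) ring_scheme \<Rightarrow> ('k, 'v, 'b) module_scheme \<Rightarrow> nat
    \<Rightarrow> ('k, ('v list \<Rightarrow> 'k) set) module" where
  "exterior_power K V m = quotient_space (tuple_space K V m) (wedge_kernel K V m)"

text \<open>
  \<open>\<Lambda>\<^sup>m T\<close>, determined by \<open>v\<^sub>1 \<and> \<dots> \<and> v\<^sub>m \<mapsto> T v\<^sub>1 \<and> \<dots> \<and> T v\<^sub>m\<close>. The union over all representatives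
  \<open>x\<close> of a coset \<open>X\<close> is a single coset when \<open>T\<close> is linear.
\<close>

definition exterior_power_map ::
  "('k, 'a) ring_scheme \<Rightarrow> ('k, 'v, 'b) module_scheme \<Rightarrow> nat \<Rightarrow> ('v \<Rightarrow> 'v)
    \<Rightarrow> ('v list \<Rightarrow> 'k) set \<Rightarrow> ('v list \<Rightarrow> 'k) set" where
  "exterior_power_map K V m T =
     (\<lambda>X\<in>carrier (exterior_power K V m).
        \<Union>x\<in>X. wedge_kernel K V m +>\<^bsub>tuple_space K V m\<^esub> free_map K (tuples V m) (map T) x)"

definition exterior_power_rep ::
  "('k, 'a) ring_scheme \<Rightarrow> ('k, 'v, 'b) module_scheme \<Rightarrow> nat \<Rightarrow> ('g \<Rightarrow> 'v \<Rightarrow> 'v)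
    \<Rightarrow> 'g \<Rightarrow> ('v list \<Rightarrow> 'k) set \<Rightarrow> ('v list \<Rightarrow> 'k) set" where
  "exterior_power_rep K V m \<rho> g = exterior_power_map K V m (\<rho> g)"


section \<open>Thick and dense representations\<close>

abbreviation subspace_dim ::
  "('k, 'a) ring_scheme \<Rightarrow> ('k, 'v, 'b) module_scheme \<Rightarrow> 'v set \<Rightarrow> nat" where
  "subspace_dim K V W \<equiv> vectorspace.dim K (V\<lparr>carrier := W\<rparr>)"

definition is_direct_sum :: "('k, 'v, 'b) module_scheme \<Rightarrow> 'v set \<Rightarrow> 'v set \<Rightarrow> bool" where
  "is_direct_sum V W1 W2 \<longleftrightarrow>
     module.submodule_sum V W1 W2 = carrier V \<and> W1 \<inter> W2 = {\<zero>\<^bsub>V\<^esub>}"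

definition m_thick ::
  "nat \<Rightarrow> ('k, 'a) ring_scheme \<Rightarrow> ('k, 'v, 'b) module_scheme \<Rightarrow> ('g, 'c) monoid_scheme
    \<Rightarrow> ('g \<Rightarrow> 'v \<Rightarrow> 'v) \<Rightarrow> bool" where
  "m_thick m K V G \<rho> \<longleftrightarrow>
     (\<forall>V1 V2. subspace K V1 V \<and> subspace K V2 V
        \<and> subspace_dim K V V1 = m \<and> subspace_dim K V V2 = vectorspace.dim K V - m
        \<longrightarrow> (\<exists>g\<in>carrier G. is_direct_sum V (\<rho> g ` V1) V2))"

definition thick ::
  "('k, 'a) ring_scheme \<Rightarrow> ('k, 'v, 'b) module_scheme \<Rightarrow> ('g, 'c) monoid_scheme
    \<Rightarrow> ('g \<Rightarrow> 'v \<Rightarrow> 'v) \<Rightarrow> bool" where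
  "thick K V G \<rho> \<longleftrightarrow> (\<forall>m. 0 < m \<and> m < vectorspace.dim K V \<longrightarrow> m_thick m K V G \<rho>)"

definition m_dense ::
  "nat \<Rightarrow> ('k, 'a) ring_scheme \<Rightarrow> ('k, 'v, 'b) module_scheme \<Rightarrow> ('g, 'c) monoid_scheme
    \<Rightarrow> ('g \<Rightarrow> 'v \<Rightarrow> 'v) \<Rightarrow> bool" where
  "m_dense m K V G \<rho> \<longleftrightarrow>
     irreducible_rep K (exterior_power K V m) G (exterior_power_rep K V m \<rho>)"

definition dense ::
  "('k, 'a) ring_scheme \<Rightarrow> ('k, 'v, 'b) module_scheme \<Rightarrow> ('g, 'c) monoid_scheme
    \<Rightarrow> ('g \<Rightarrow> 'v \<Rightarrow> 'v) \<Rightarrow> bool" where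
  "dense K V G \<rho> \<longleftrightarrow> (\<forall>m. 0 < m \<and> m < vectorspace.dim K V \<longrightarrow> m_dense m K V G \<rho>)"

end

theory Submission
  imports Defs "HOL-Combinatorics.Permutations"
begin

text \<open>
  Dense implies thick: let \<open>V1\<close>, \<open>V2\<close> have dimensions \<open>m\<close> and \<open>n - m\<close>, let \<open>D\<close> be the determinant of
  \<open>m\<close> vectors modulo \<open>V2\<close>, and let \<open>x\<close> be a basis of \<open>V1\<close>. If no translate of \<open>V1\<close> is complementary
  to \<open>V2\<close>, then \<open>D\<close> vanishes on \<open>\<rho> g x\<close> for every \<open>g\<close>, so the common kernel of the functionals
  \<open>D \<circ> \<Lambda>\<^sup>m (\<rho> g)\<close> is an invariant subspace of \<open>\<Lambda>\<^sup>m V\<close>. It contains the class of \<open>x\<close>, which is nonzero,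
  but not the class of a basis of a complement of \<open>V2\<close>, on which \<open>D\<close> is \<open>1\<close>.

  Thick implies irreducible: if \<open>W\<close> is a nontrivial invariant subspace of dimension \<open>m\<close>, choose \<open>V2\<close>
  of dimension \<open>n - m\<close> with \<open>V2 \<subseteq> W\<close> or \<open>W \<subseteq> V2\<close>. Then \<open>\<rho> g W + V2\<close> is never all of \<open>V\<close>.
\<close>

section \<open>Linear functionals and linear maps on free vector spaces\<close>

context cring
begin

text \<open>The functional on the free space with value \<open>D s\<close> at the generator of
  \<open>s\<close>. Only the support is summed over, since \<open>finsum\<close> over an infinite
  index set returns the default zero.\<close>

definition lin_ext :: "'s set \<Rightarrow> ('s \<Rightarrow> 'a) \<Rightarrow> ('s \<Rightarrow> 'a) \<Rightarrow> 'a" where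
  "lin_ext S D f = (\<Oplus>s\<in>{s \<in> S. f s \<noteq> \<zero>}. f s \<otimes> D s)"

lemma free_space_simps:
  "carrier (free_space R S) = {f \<in> S \<rightarrow>\<^sub>E carrier R. finite {s \<in> S. f s \<noteq> \<zero>}}"
  "\<zero>\<^bsub>free_space R S\<^esub> = (\<lambda>s\<in>S. \<zero>)"
  "f \<oplus>\<^bsub>free_space R S\<^esub> g = (\<lambda>s\<in>S. f s \<oplus> g s)"
  "c \<odot>\<^bsub>free_space R S\<^esub> f = (\<lambda>s\<in>S. c \<otimes> f s)"
  by (simp_all add: free_space_def func_space_def)

text \<open>The functions of finite support form a submodule of all functions from \<open>S\<close>
  to \<open>R\<close>: the support of a sum lies in the union of the supports, and scaling never
  enlarges a support.\<close>

lemma module_free_space: "module R (free_space R S)"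
proof -
  interpret F: module R "func_space S" by (rule func_space_is_module)
  have "submodule R (carrier (free_space R S)) (func_space S)"
  proof
    fix v w assume "v \<in> carrier (free_space R S)" "w \<in> carrier (free_space R S)"
    then have "finite ({s \<in> S. v s \<noteq> \<zero>} \<union> {s \<in> S. w s \<noteq> \<zero>})" and "v \<in> S \<rightarrow> carrier R" "w \<in> S \<rightarrow> carrier R"
      by (auto simp: free_space_simps)
    moreover have "{s \<in> S. v s \<oplus> w s \<noteq> \<zero>} \<subseteq> {s \<in> S. v s \<noteq> \<zero>} \<union> {s \<in> S. w s \<noteq> \<zero>}" by auto
    ultimately show "v \<oplus>\<^bsub>func_space S\<^esub> w \<in> carrier (free_space R S)"
      by (auto simp: free_space_simps func_space_def intro: finite_subset cong: conj_cong)
  next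
    fix c v assume c: "c \<in> carrier R" and v: "v \<in> carrier (free_space R S)"
    then have "{s \<in> S. c \<otimes> v s \<noteq> \<zero>} \<subseteq> {s \<in> S. v s \<noteq> \<zero>}" by auto
    with c v show "c \<odot>\<^bsub>func_space S\<^esub> v \<in> carrier (free_space R S)"
      by (auto simp: free_space_simps func_space_def intro: finite_subset cong: conj_cong)
  qed (auto simp: free_space_simps func_space_def F.module_axioms cong: conj_cong)
  from F.submodule_is_module[OF this] show ?thesis by (simp add: free_space_def)
qed

lemma free_gen_closed: "s \<in> S \<Longrightarrow> free_gen R S s \<in> carrier (free_space R S)"
  by (auto simp: free_space_simps free_gen_def cong: conj_cong)

text \<open>Terms off the support vanish, so any finite index set containing it gives the same sum.
  This puts vectors with different supports over a common index set.\<close>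

lemma lin_ext_eq:
  assumes "f \<in> carrier (free_space R S)" "D \<in> S \<rightarrow> carrier R"
    and "finite A" "A \<subseteq> S" "{s \<in> S. f s \<noteq> \<zero>} \<subseteq> A"
  shows "lin_ext S D f = (\<Oplus>s\<in>A. f s \<otimes> D s)"
  unfolding lin_ext_def using assms
  by (intro add.finprod_mono_neutral_cong_left) (auto simp: free_space_simps PiE_iff Pi_iff subset_iff)

lemma lin_ext_closed:
  "f \<in> carrier (free_space R S) \<Longrightarrow> D \<in> S \<rightarrow> carrier R \<Longrightarrow> lin_ext S D f \<in> carrier R"
  unfolding lin_ext_def by (intro finsum_closed) (auto simp: free_space_simps PiE_iff Pi_iff)

lemma lin_ext_add:
  assumes f: "f \<in> carrier (free_space R S)" and g: "g \<in> carrier (free_space R S)"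
    and D: "D \<in> S \<rightarrow> carrier R"
  shows "lin_ext S D (f \<oplus>\<^bsub>free_space R S\<^esub> g) = lin_ext S D f \<oplus> lin_ext S D g"
proof -
  interpret F: module R "free_space R S" by (rule module_free_space)
  let ?A = "{s \<in> S. f s \<noteq> \<zero>} \<union> {s \<in> S. g s \<noteq> \<zero>}"
  have A: "finite ?A" "?A \<subseteq> S" using f g by (auto simp: free_space_simps)
  have fc: "f s \<in> carrier R" "g s \<in> carrier R" "D s \<in> carrier R" if "s \<in> ?A" for s
    using that f g D by (auto simp: free_space_simps)
  have "lin_ext S D (f \<oplus>\<^bsub>free_space R S\<^esub> g) = (\<Oplus>s\<in>?A. (f \<oplus>\<^bsub>free_space R S\<^esub> g) s \<otimes> D s)"
    by (rule lin_ext_eq) (use A f g D in \<open>auto simp: F.a_closed, auto simp: free_space_simps(3)\<close>)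
  also have "\<dots> = (\<Oplus>s\<in>?A. f s \<otimes> D s \<oplus> g s \<otimes> D s)"
    by (rule add.finprod_cong') (use fc in \<open>auto simp: free_space_simps(3) l_distr\<close>)
  also have "\<dots> = (\<Oplus>s\<in>?A. f s \<otimes> D s) \<oplus> (\<Oplus>s\<in>?A. g s \<otimes> D s)"
    by (rule add.finprod_multf) (use fc in auto)
  also have "(\<Oplus>s\<in>?A. f s \<otimes> D s) = lin_ext S D f"
    by (rule lin_ext_eq[symmetric]) (use A f g D in auto)
  also have "(\<Oplus>s\<in>?A. g s \<otimes> D s) = lin_ext S D g"
    by (rule lin_ext_eq[symmetric]) (use A f g D in auto)
  finally show ?thesis .
qed

lemma lin_ext_smult:
  assumes f: "f \<in> carrier (free_space R S)" and c: "c \<in> carrier R"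
    and D: "D \<in> S \<rightarrow> carrier R"
  shows "lin_ext S D (c \<odot>\<^bsub>free_space R S\<^esub> f) = c \<otimes> lin_ext S D f"
proof -
  interpret F: module R "free_space R S" by (rule module_free_space)
  let ?A = "{s \<in> S. f s \<noteq> \<zero>}"
  have A: "finite ?A" "?A \<subseteq> S" using f by (auto simp: free_space_simps)
  have fc: "f s \<in> carrier R" "D s \<in> carrier R" if "s \<in> ?A" for s
    using that f D by (auto simp: free_space_simps)
  have "lin_ext S D (c \<odot>\<^bsub>free_space R S\<^esub> f) = (\<Oplus>s\<in>?A. (c \<odot>\<^bsub>free_space R S\<^esub> f) s \<otimes> D s)"
    by (rule lin_ext_eq) (use A f D c in \<open>auto simp: F.smult_closed, auto simp: free_space_simps(4)\<close>)
  also have "\<dots> = (\<Oplus>s\<in>?A. c \<otimes> (f s \<otimes> D s))"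
    by (rule add.finprod_cong') (use fc c in \<open>auto simp: free_space_simps(4) m_assoc\<close>)
  also have "\<dots> = c \<otimes> (\<Oplus>s\<in>?A. f s \<otimes> D s)"
    by (rule finsum_rdistr[symmetric]) (use A fc c in auto)
  finally show ?thesis by (simp add: lin_ext_def)
qed

lemma lin_ext_free_gen:
  assumes "s \<in> S" "D \<in> S \<rightarrow> carrier R"
  shows "lin_ext S D (free_gen R S s) = D s"
proof -
  have "lin_ext S D (free_gen R S s) = (\<Oplus>t\<in>{s}. free_gen R S s t \<otimes> D t)"
    by (rule lin_ext_eq) (use assms free_gen_closed in \<open>auto simp: free_gen_def\<close>)
  also have "\<dots> = D s" using assms by (auto simp: free_gen_def Pi_iff)
  finally show ?thesis .
qed

lemma submodule_lin_ext_ker: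
  assumes D: "D \<in> S \<rightarrow> carrier R"
  shows "submodule R {f \<in> carrier (free_space R S). lin_ext S D f = \<zero>} (free_space R S)"
proof -
  interpret F: module R "free_space R S" by (rule module_free_space)
  have "lin_ext S D \<zero>\<^bsub>free_space R S\<^esub> = \<zero>"
    using lin_ext_smult[OF F.zero_closed zero_closed D] lin_ext_closed[OF F.zero_closed D] by simp
  then show ?thesis
    by unfold_locales (auto simp: lin_ext_add lin_ext_smult D)
qed

text \<open>Peeling off one coordinate at a time writes a finitely supported vector as a combination
  of generators. This reduces identities linear in \<open>f\<close> to generators.\<close>

lemma free_space_generated:
  assumes W: "submodule R W (free_space R S)"
    and gen: "\<And>s. s \<in> S \<Longrightarrow> free_gen R S s \<in> W"
    and f: "f \<in> carrier (free_space R S)"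
  shows "f \<in> W"
proof -
  interpret W: submodule R W "free_space R S" by (rule W)
  \<comment> \<open>The induction runs over a finite superset \<open>A\<close> of the support rather
    than the support itself, so that clearing a coordinate only has to keep the support inside
    \<open>A\<close>.\<close>
  have "f \<in> W" if "finite A" "f \<in> carrier (free_space R S)" "{s \<in> S. f s \<noteq> \<zero>} \<subseteq> A" for A f
    using that
  proof (induction A arbitrary: f rule: finite_induct)
    case empty
    then have "f = \<zero>\<^bsub>free_space R S\<^esub>" by (auto simp: free_space_simps PiE_iff fun_eq_iff extensional_def)
    then show ?case using W.zero_closed by simp
  next
    case (insert a A)
    show ?case
    proof (cases "a \<in> S")
      \<comment> \<open>A point outside \<open>S\<close> is not in the support, so the support
        already lies in \<open>A\<close>.\<close>
      case False
      with insert show ?thesis by blast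
    next
      case True
      define g where "g = f(a := \<zero>)"
      have "finite {s \<in> S. g s \<noteq> \<zero>}"
        by (rule finite_subset[of _ "{s \<in> S. f s \<noteq> \<zero>}"])
          (use insert.prems in \<open>auto simp: g_def free_space_simps\<close>)
      moreover have "g \<in> S \<rightarrow>\<^sub>E carrier R"
        using insert.prems True by (auto simp: free_space_simps g_def PiE_iff extensional_def)
      ultimately have g: "g \<in> carrier (free_space R S)" by (simp add: free_space_simps(1))
      have "g \<in> W" using insert.prems by (intro insert.IH[OF g]) (auto simp: g_def)
      moreover have "f a \<in> carrier R" using insert.prems True by (auto simp: free_space_simps)
      moreover have "f = g \<oplus>\<^bsub>free_space R S\<^esub> f a \<odot>\<^bsub>free_space R S\<^esub> free_gen R S a"
        using insert.prems True
        by (auto simp: free_space_simps g_def free_gen_def PiE_iff extensional_def fun_eq_iff)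
      ultimately show ?thesis using gen[OF True] W.m_closed W.smult_closed by metis
    qed
  qed
  from this[of "{s \<in> S. f s \<noteq> \<zero>}" f] f show ?thesis by (auto simp: free_space_simps)
qed

section \<open>Linear maps induced by maps of the generators\<close>

lemma free_map_eq:
  assumes f: "f \<in> carrier (free_space R S)"
  shows "free_map R S h f = (\<lambda>t\<in>S. lin_ext S (\<lambda>s. if h s = t then \<one> else \<zero>) f)"
proof -
  \<comment> \<open>The coordinate of the image at \<open>t\<close> is the functional attached to
    the indicator of the fibre of \<open>h\<close> over \<open>t\<close>; linearity of
    \<open>free_map\<close> is then inherited from \<open>lin_ext\<close>.\<close>
  have "(\<Oplus>s\<in>{s \<in> S. f s \<noteq> \<zero> \<and> h s = t}. f s) = lin_ext S (\<lambda>s. if h s = t then \<one> else \<zero>) f" for t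
    unfolding lin_ext_def using f
    by (intro add.finprod_mono_neutral_cong_left) (auto simp: free_space_simps PiE_iff)
  then show ?thesis by (simp add: free_map_def)
qed

lemma free_map_closed:
  assumes h: "h \<in> S \<rightarrow> S" and f: "f \<in> carrier (free_space R S)"
  shows "free_map R S h f \<in> carrier (free_space R S)"
proof -
  have "lin_ext S (\<lambda>s. if h s = t then \<one> else \<zero>) f \<in> carrier R" for t
    by (rule lin_ext_closed[OF f]) auto
  \<comment> \<open>A sum over an empty fibre is zero, so the new support lies in the image of the
    old one and is finite.\<close>
  moreover have "{t \<in> S. free_map R S h f t \<noteq> \<zero>} \<subseteq> h ` {s \<in> S. f s \<noteq> \<zero>}"
  proof
    fix t assume t: "t \<in> {t \<in> S. free_map R S h f t \<noteq> \<zero>}"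
    show "t \<in> h ` {s \<in> S. f s \<noteq> \<zero>}"
    proof (rule ccontr)
      assume "\<not> ?thesis"
      then have "{s \<in> S. f s \<noteq> \<zero> \<and> h s = t} = {}" by auto
      then have "(\<Oplus>s\<in>{s \<in> S. f s \<noteq> \<zero> \<and> h s = t}. f s) = \<zero>" by (simp only: finsum_empty)
      with t show False by (auto simp: free_map_def)
    qed
  qed
  then have "finite {t \<in> S. free_map R S h f t \<noteq> \<zero>}"
    using f by (auto simp: free_space_simps intro: finite_subset)
  ultimately show ?thesis by (simp add: free_space_simps(1)) (simp add: free_map_eq[OF f])
qed

lemma free_map_hom:
  assumes h: "h \<in> S \<rightarrow> S"
  shows "free_map R S h \<in> module_hom R (free_space R S) (free_space R S)"
proof -
  interpret F: module R "free_space R S" by (rule module_free_space)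
  have D: "(\<lambda>s. if h s = t then \<one> else \<zero>) \<in> S \<rightarrow> carrier R" for t by auto
  show ?thesis unfolding module_hom_def
    by (auto simp: free_map_closed[OF h]) (simp_all add: free_map_eq lin_ext_add[OF _ _ D] lin_ext_smult[OF _ _ D],
      auto simp: free_space_simps fun_eq_iff)
qed

lemma free_map_free_gen:
  assumes "h \<in> S \<rightarrow> S" "s \<in> S"
  shows "free_map R S h (free_gen R S s) = free_gen R S (h s)"
proof -
  have "lin_ext S (\<lambda>s. if h s = t then \<one> else \<zero>) (free_gen R S s) = (if h s = t then \<one> else \<zero>)" for t
    by (rule lin_ext_free_gen) (use assms in auto)
  then show ?thesis
    unfolding free_map_eq[OF free_gen_closed[OF assms(2)]] by (auto simp: free_gen_def fun_eq_iff)
qed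

text \<open>Both sides are linear in \<open>f\<close>, so the vectors where they agree form a
  submodule, and this submodule contains every generator.\<close>

lemma lin_ext_free_map:
  assumes h: "h \<in> S \<rightarrow> S" and D: "D \<in> S \<rightarrow> carrier R" and f: "f \<in> carrier (free_space R S)"
  shows "lin_ext S D (free_map R S h f) = lin_ext S (D \<circ> h) f"
proof -
  interpret F: module R "free_space R S" by (rule module_free_space)
  interpret h: mod_hom R "free_space R S" "free_space R S" "free_map R S h"
    by unfold_locales (rule free_map_hom[OF h])
  have Dh: "D \<circ> h \<in> S \<rightarrow> carrier R" using h D by auto
  have z: "lin_ext S E \<zero>\<^bsub>free_space R S\<^esub> = \<zero>" if "E \<in> S \<rightarrow> carrier R" for E
    using submodule.zero_closed[OF submodule_lin_ext_ker[OF that]] by simp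
  let ?W = "{f \<in> carrier (free_space R S). lin_ext S D (free_map R S h f) = lin_ext S (D \<circ> h) f}"
  have W: "submodule R ?W (free_space R S)"
    by unfold_locales (auto simp: lin_ext_add lin_ext_smult D Dh z)
  have "lin_ext S D (free_map R S h (free_gen R S s)) = lin_ext S (D \<circ> h) (free_gen R S s)"
    if s: "s \<in> S" for s
    using lin_ext_free_gen[OF _ D, of "h s"] lin_ext_free_gen[OF s Dh] funcset_mem[OF h s]
    by (simp add: free_map_free_gen[OF h s])
  then have "f \<in> ?W" by (intro free_space_generated[OF W _ f]) (simp add: free_gen_closed)
  then show ?thesis by simp
qed

end

section \<open>Quotients and exterior powers\<close>

context module
begin

text \<open>Negation is multiplication by \<open>-1\<close>, under which a submodule is closed. This
  makes the calculus of additive cosets available for submodules.\<close>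

lemma submodule_abelian_subgroup:
  assumes "submodule R N M"
  shows "abelian_subgroup N M"
proof -
  interpret N: submodule R N M by (rule assms)
  have "\<ominus>\<^bsub>M\<^esub> x \<in> N" if "x \<in> N" for x
    using that N.subset N.smult_closed[OF R.a_inv_closed[OF R.one_closed], of x] smult_minus_1[of x]
    by (simp add: subset_iff)
  then have "subgroup N (add_monoid M)"
    using N.subset by unfold_locales (auto simp flip: a_inv_def)
  then show ?thesis
    using M.abelian_group_axioms additive_subgroupI abelian_subgroupI3 by blast
qed

text \<open>Representatives of one coset differ by elements of \<open>N\<close>, which
  \<open>\<phi>\<close> keeps in \<open>N\<close>, so all cosets in the union coincide. Unions of
  this shape define both scalar multiplication on quotients and the induced maps on exterior
  powers.\<close>

lemma coset_map:
  assumes N: "submodule R N M" and \<phi>: "\<phi> \<in> module_hom R M M" "\<phi> ` N \<subseteq> N" and a: "a \<in> carrier M"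
  shows "(\<Union>x\<in>N +>\<^bsub>M\<^esub> a. N +>\<^bsub>M\<^esub> \<phi> x) = N +>\<^bsub>M\<^esub> \<phi> a"
proof -
  interpret N: submodule R N M by (rule N)
  interpret S: abelian_subgroup N M by (rule submodule_abelian_subgroup[OF N])
  interpret \<phi>: mod_hom R M M \<phi> by unfold_locales (rule \<phi>)
  have "N +>\<^bsub>M\<^esub> \<phi> x = N +>\<^bsub>M\<^esub> \<phi> a" if x: "x \<in> N +>\<^bsub>M\<^esub> a" for x
  proof -
    obtain n where n: "n \<in> N" "x = n \<oplus>\<^bsub>M\<^esub> a" using x by (auto simp: a_r_coset_def')
    have nc: "n \<in> carrier M" using n N.subset by auto
    have "\<phi> x = \<phi> n \<oplus>\<^bsub>M\<^esub> \<phi> a" using n a nc by simp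
    then have "\<phi> x \<in> N +>\<^bsub>M\<^esub> \<phi> a" using n \<phi>(2) by (auto simp: a_r_coset_def')
    then show ?thesis using S.a_repr_independence'[of "\<phi> x" "\<phi> a"] a by simp
  qed
  moreover have "a \<in> N +>\<^bsub>M\<^esub> a" by (rule S.a_rcos_self[OF a])
  ultimately show ?thesis by blast
qed

lemma quotient_space_simps:
  assumes N: "submodule R N M"
  shows "carrier (quotient_space M N) = (\<lambda>x. N +>\<^bsub>M\<^esub> x) ` carrier M"
    and "\<zero>\<^bsub>quotient_space M N\<^esub> = N"
    and "a \<in> carrier M \<Longrightarrow> b \<in> carrier M \<Longrightarrow>
      (N +>\<^bsub>M\<^esub> a) \<oplus>\<^bsub>quotient_space M N\<^esub> (N +>\<^bsub>M\<^esub> b) = N +>\<^bsub>M\<^esub> (a \<oplus>\<^bsub>M\<^esub> b)"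
    and "c \<in> carrier R \<Longrightarrow> a \<in> carrier M \<Longrightarrow>
      c \<odot>\<^bsub>quotient_space M N\<^esub> (N +>\<^bsub>M\<^esub> a) = N +>\<^bsub>M\<^esub> (c \<odot>\<^bsub>M\<^esub> a)"
proof -
  interpret N: submodule R N M by (rule N)
  interpret S: abelian_subgroup N M by (rule submodule_abelian_subgroup[OF N])
  show "carrier (quotient_space M N) = (\<lambda>x. N +>\<^bsub>M\<^esub> x) ` carrier M"
    by (auto simp: quotient_space_def A_RCOSETS_def')
  show "\<zero>\<^bsub>quotient_space M N\<^esub> = N" by (simp add: quotient_space_def)
  show "(N +>\<^bsub>M\<^esub> a) \<oplus>\<^bsub>quotient_space M N\<^esub> (N +>\<^bsub>M\<^esub> b) = N +>\<^bsub>M\<^esub> (a \<oplus>\<^bsub>M\<^esub> b)"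
    if "a \<in> carrier M" "b \<in> carrier M"
    using S.a_rcos_sum[OF that] by (simp add: quotient_space_def)
  show "c \<odot>\<^bsub>quotient_space M N\<^esub> (N +>\<^bsub>M\<^esub> a) = N +>\<^bsub>M\<^esub> (c \<odot>\<^bsub>M\<^esub> a)"
    if c: "c \<in> carrier R" and a: "a \<in> carrier M"
  proof -
    \<comment> \<open>Scaling by \<open>c\<close> is an endomorphism because the base ring is
      commutative, and it preserves \<open>N\<close>; so \<open>coset_map\<close> evaluates the
      union in the definition of \<open>smult\<close>.\<close>
    have "(\<lambda>x. c \<odot>\<^bsub>M\<^esub> x) \<in> module_hom R M M"
      using c by (auto simp: module_hom_def smult_r_distr smult_assoc_simp R.m_comm)
    from coset_map[OF N this _ a] show ?thesis
      using c by (auto simp: quotient_space_def)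
  qed
qed

lemma quotient_space_zero: "submodule R N M \<Longrightarrow> N +>\<^bsub>M\<^esub> \<zero>\<^bsub>M\<^esub> = N"
  by (rule M.a_coset_add_zero[OF submodule.subset])

lemma module_quotient_space:
  assumes N: "submodule R N M"
  shows "module R (quotient_space M N)"
proof -
  let ?Q = "quotient_space M N" and ?\<pi> = "\<lambda>x. N +>\<^bsub>M\<^esub> x"
  note Q = quotient_space_simps[OF N]
  have z: "?\<pi> \<zero>\<^bsub>M\<^esub> = N" by (rule quotient_space_zero[OF N])
  \<comment> \<open>Quantifiers over pairs of cosets become quantifiers over representatives, on
    which the operations are known.\<close>
  have ball: "(\<forall>v w. v \<in> carrier ?Q \<and> w \<in> carrier ?Q \<longrightarrow> P v w) \<longleftrightarrow>
      (\<forall>a\<in>carrier M. \<forall>b\<in>carrier M. P (?\<pi> a) (?\<pi> b))" for P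
    unfolding Q by blast
  show ?thesis
  proof (rule module_criteria)
    show "\<zero>\<^bsub>?Q\<^esub> \<in> carrier ?Q"
      using imageI[OF M.zero_closed, of ?\<pi>] by (simp only: Q z)
    show "\<forall>v w. v \<in> carrier ?Q \<and> w \<in> carrier ?Q \<longrightarrow> v \<oplus>\<^bsub>?Q\<^esub> w \<in> carrier ?Q"
      unfolding ball by (simp add: Q)
    show "\<forall>v\<in>carrier ?Q. \<exists>w\<in>carrier ?Q. v \<oplus>\<^bsub>?Q\<^esub> w = \<zero>\<^bsub>?Q\<^esub>"
    proof
      fix v assume "v \<in> carrier ?Q"
      then obtain a where a: "a \<in> carrier M" "v = ?\<pi> a" by (auto simp: Q)
      then have "v \<oplus>\<^bsub>?Q\<^esub> ?\<pi> (\<ominus>\<^bsub>M\<^esub> a) = \<zero>\<^bsub>?Q\<^esub>"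
        using z by (simp add: Q M.r_neg)
      with a show "\<exists>w\<in>carrier ?Q. v \<oplus>\<^bsub>?Q\<^esub> w = \<zero>\<^bsub>?Q\<^esub>" by (auto simp: Q)
    qed
    show "\<forall>c v. c \<in> carrier R \<and> v \<in> carrier ?Q \<longrightarrow> c \<odot>\<^bsub>?Q\<^esub> v \<in> carrier ?Q"
      by (auto simp: Q)
    show "\<forall>v w. v \<in> carrier ?Q \<and> w \<in> carrier ?Q \<longrightarrow> v \<oplus>\<^bsub>?Q\<^esub> w = w \<oplus>\<^bsub>?Q\<^esub> v"
      unfolding ball using M.a_comm by (simp add: Q)
    show "\<forall>v w x. v \<in> carrier ?Q \<and> w \<in> carrier ?Q \<and> x \<in> carrier ?Q \<longrightarrow>
        v \<oplus>\<^bsub>?Q\<^esub> w \<oplus>\<^bsub>?Q\<^esub> x = v \<oplus>\<^bsub>?Q\<^esub> (w \<oplus>\<^bsub>?Q\<^esub> x)"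
      by (auto simp: Q M.a_assoc)
    show "\<forall>v\<in>carrier ?Q. v \<oplus>\<^bsub>?Q\<^esub> \<zero>\<^bsub>?Q\<^esub> = v"
      using Q(3)[OF _ M.zero_closed] z by (auto simp: Q)
    show "\<forall>a b v. a \<in> carrier R \<and> b \<in> carrier R \<and> v \<in> carrier ?Q \<longrightarrow>
        (a \<otimes>\<^bsub>R\<^esub> b) \<odot>\<^bsub>?Q\<^esub> v = a \<odot>\<^bsub>?Q\<^esub> (b \<odot>\<^bsub>?Q\<^esub> v)"
      by (auto simp: Q smult_assoc1)
    show "\<forall>v\<in>carrier ?Q. \<one>\<^bsub>R\<^esub> \<odot>\<^bsub>?Q\<^esub> v = v"
      by (auto simp: Q)
    show "\<forall>a b v. a \<in> carrier R \<and> b \<in> carrier R \<and> v \<in> carrier ?Q \<longrightarrow>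
        (a \<oplus>\<^bsub>R\<^esub> b) \<odot>\<^bsub>?Q\<^esub> v = a \<odot>\<^bsub>?Q\<^esub> v \<oplus>\<^bsub>?Q\<^esub> b \<odot>\<^bsub>?Q\<^esub> v"
      by (auto simp: Q smult_l_distr)
    show "\<forall>a v w. a \<in> carrier R \<and> v \<in> carrier ?Q \<and> w \<in> carrier ?Q \<longrightarrow>
        a \<odot>\<^bsub>?Q\<^esub> (v \<oplus>\<^bsub>?Q\<^esub> w) = a \<odot>\<^bsub>?Q\<^esub> v \<oplus>\<^bsub>?Q\<^esub> a \<odot>\<^bsub>?Q\<^esub> w"
    proof (intro allI impI, elim conjE)
      fix c v w assume c: "c \<in> carrier R" and "v \<in> carrier ?Q" "w \<in> carrier ?Q"
      then obtain a b where "a \<in> carrier M" "v = ?\<pi> a" "b \<in> carrier M" "w = ?\<pi> b"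
        unfolding Q by blast
      with c show "c \<odot>\<^bsub>?Q\<^esub> (v \<oplus>\<^bsub>?Q\<^esub> w) = c \<odot>\<^bsub>?Q\<^esub> v \<oplus>\<^bsub>?Q\<^esub> c \<odot>\<^bsub>?Q\<^esub> w"
        by (simp add: Q smult_r_distr)
    qed
    show "cring R" by (rule R.is_cring)
  qed
qed

lemma submodule_quotient_space:
  assumes N: "submodule R N M" and U: "submodule R U M"
  shows "submodule R ((\<lambda>x. N +>\<^bsub>M\<^esub> x) ` U) (quotient_space M N)"
proof -
  interpret Q: module R "quotient_space M N" by (rule module_quotient_space[OF N])
  interpret U: submodule R U M by (rule U)
  note [simp] = quotient_space_simps[OF N]
  show ?thesis
  proof
    show "\<zero>\<^bsub>quotient_space M N\<^esub> \<in> (\<lambda>x. N +>\<^bsub>M\<^esub> x) ` U"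
      using quotient_space_zero[OF N] U.zero_closed by (auto intro!: image_eqI[where x = "\<zero>\<^bsub>M\<^esub>"])
  qed (use U.subset in \<open>auto simp: subset_iff\<close>)
qed

text \<open>Representatives of equal cosets differ by an element of \<open>N\<close>, which already
  lies in \<open>U\<close>. Thus a submodule containing \<open>N\<close> can be recovered from its
  image in the quotient.\<close>

lemma coset_mem_image:
  assumes N: "submodule R N M" and U: "submodule R U M" and "N \<subseteq> U"
    and x: "x \<in> carrier M" "N +>\<^bsub>M\<^esub> x \<in> (\<lambda>x. N +>\<^bsub>M\<^esub> x) ` U"
  shows "x \<in> U"
proof -
  interpret U: submodule R U M by (rule U)
  interpret S: abelian_subgroup N M by (rule submodule_abelian_subgroup[OF N])
  obtain u where u: "u \<in> U" "N +>\<^bsub>M\<^esub> x = N +>\<^bsub>M\<^esub> u" using x by auto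
  with S.a_rcos_self[OF x(1)] obtain n where "n \<in> N" "x = n \<oplus>\<^bsub>M\<^esub> u" by (auto simp: a_r_coset_def')
  with u \<open>N \<subseteq> U\<close> show ?thesis by auto
qed

end

section \<open>Relations of the exterior power and its invariant subspaces\<close>

context vectorspace
begin

lemma map_tuples: "T \<in> carrier V \<rightarrow> carrier V \<Longrightarrow> map T \<in> tuples V m \<rightarrow> tuples V m"
  by (fastforce simp: tuples_def)

lemma update_tuples: "xs \<in> tuples V m \<Longrightarrow> v \<in> carrier V \<Longrightarrow> xs[i := v] \<in> tuples V m"
  using set_update_subset_insert[of xs i v] by (auto simp: tuples_def)

lemma wedge_relations_cases [consumes 1, case_names add smult alt]:
  assumes "r \<in> wedge_relations K V m"
  obtains (add) xs i v w where "xs \<in> tuples V m" "i < m" "v \<in> carrier V" "w \<in> carrier V"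
      "r = free_gen K (tuples V m) (xs[i := v \<oplus>\<^bsub>V\<^esub> w]) \<ominus>\<^bsub>free_space K (tuples V m)\<^esub>
        (free_gen K (tuples V m) (xs[i := v]) \<oplus>\<^bsub>free_space K (tuples V m)\<^esub> free_gen K (tuples V m) (xs[i := w]))"
  | (smult) xs i c v where "xs \<in> tuples V m" "i < m" "c \<in> carrier K" "v \<in> carrier V"
      "r = free_gen K (tuples V m) (xs[i := c \<odot>\<^bsub>V\<^esub> v]) \<ominus>\<^bsub>free_space K (tuples V m)\<^esub>
        (c \<odot>\<^bsub>free_space K (tuples V m)\<^esub> free_gen K (tuples V m) (xs[i := v]))"
  | (alt) xs i j where "xs \<in> tuples V m" "i < j" "j < m" "xs ! i = xs ! j" "r = free_gen K (tuples V m) xs"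
  using assms unfolding wedge_relations_def Let_def
  by (elim UnE CollectE exE conjE) (rule that; assumption)+

lemma wedge_relations_subset: "wedge_relations K V m \<subseteq> carrier (free_space K (tuples V m))"
proof
  interpret F: module K "free_space K (tuples V m)" by (rule module_free_space)
  fix r assume "r \<in> wedge_relations K V m"
  then show "r \<in> carrier (free_space K (tuples V m))"
    by (cases rule: wedge_relations_cases) (simp_all add: free_gen_closed update_tuples)
qed

lemma submodule_wedge_kernel: "submodule K (wedge_kernel K V m) (free_space K (tuples V m))"
proof -
  interpret F: module K "free_space K (tuples V m)" by (rule module_free_space)
  show ?thesis unfolding wedge_kernel_def by (rule F.span_is_submodule[OF wedge_relations_subset])
qed

lemma wedge_kernel_subset:
  assumes "submodule K U (free_space K (tuples V m))" "wedge_relations K V m \<subseteq> U"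
  shows "wedge_kernel K V m \<subseteq> U"
proof -
  interpret F: module K "free_space K (tuples V m)" by (rule module_free_space)
  show ?thesis unfolding wedge_kernel_def by (rule F.span_is_subset[OF assms(2,1)])
qed

lemma wedge_relations_subset_kernel: "wedge_relations K V m \<subseteq> wedge_kernel K V m"
proof -
  interpret F: module K "free_space K (tuples V m)" by (rule module_free_space)
  show ?thesis unfolding wedge_kernel_def by (rule F.in_own_span[OF wedge_relations_subset])
qed

text \<open>A linear \<open>T\<close> carries each relation to a relation of the same kind, and the
  span follows. This makes the induced map on the exterior power independent of
  representatives.\<close>

lemma free_map_wedge_kernel:
  assumes T: "T \<in> module_hom K V V"
  shows "free_map K (tuples V m) (map T) ` wedge_kernel K V m \<subseteq> wedge_kernel K V m"
proof -
  let ?F = "free_space K (tuples V m)" and ?N = "wedge_kernel K V m"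
    and ?e = "free_gen K (tuples V m)" and ?\<phi> = "free_map K (tuples V m) (map T)"
  interpret F: module K ?F by (rule module_free_space)
  interpret N: submodule K ?N ?F by (rule submodule_wedge_kernel)
  interpret T: mod_hom K V V T by unfold_locales (rule T)
  have Tc: "T \<in> carrier V \<rightarrow> carrier V" by auto
  note mt = map_tuples[OF Tc]
  interpret \<phi>: mod_hom K ?F ?F ?\<phi> by unfold_locales (rule free_map_hom[OF mt])
  have e: "?\<phi> (?e xs) = ?e (map T xs)" "?e xs \<in> carrier ?F" "map T xs \<in> tuples V m" if "xs \<in> tuples V m" for xs
    using free_map_free_gen[OF mt that] free_gen_closed[OF that] funcset_mem[OF mt that] by auto
  \<comment> \<open>The vectors sent into the kernel form a submodule, so it suffices to send the
    generating relations there.\<close>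
  have U: "submodule K {f \<in> carrier ?F. ?\<phi> f \<in> ?N} ?F"
    by unfold_locales auto
  have "wedge_relations K V m \<subseteq> {f \<in> carrier ?F. ?\<phi> f \<in> ?N}"
  proof
    fix r assume r: "r \<in> wedge_relations K V m"
    from r have "?\<phi> r \<in> wedge_relations K V m"
    proof (cases rule: wedge_relations_cases)
      case (add xs i v w)
      then have "?\<phi> r = ?e ((map T xs)[i := T v \<oplus>\<^bsub>V\<^esub> T w]) \<ominus>\<^bsub>?F\<^esub> (?e ((map T xs)[i := T v]) \<oplus>\<^bsub>?F\<^esub> ?e ((map T xs)[i := T w]))"
        by (simp add: e update_tuples map_update)
      with add e(3)[of xs] show ?thesis unfolding wedge_relations_def Let_def by blast
    next
      case (smult xs i c v)
      then have "?\<phi> r = ?e ((map T xs)[i := c \<odot>\<^bsub>V\<^esub> T v]) \<ominus>\<^bsub>?F\<^esub> (c \<odot>\<^bsub>?F\<^esub> ?e ((map T xs)[i := T v]))"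
        by (simp add: e update_tuples map_update)
      with smult e(3)[of xs] show ?thesis unfolding wedge_relations_def Let_def by blast
    next
      case (alt xs i j)
      then have "?\<phi> r = ?e (map T xs)" "map T xs ! i = map T xs ! j"
        using e(1)[of xs] by (auto simp: tuples_def)
      with alt e(3)[of xs] show ?thesis unfolding wedge_relations_def Let_def by blast
    qed
    with r show "r \<in> {f \<in> carrier ?F. ?\<phi> f \<in> ?N}"
      using wedge_relations_subset wedge_relations_subset_kernel by blast
  qed
  from wedge_kernel_subset[OF U this] show ?thesis by auto
qed

text \<open>Submodules of the quotient correspond to submodules above the kernel, compatibly with
  the action. Irreducibility can thereby be applied inside the free space.\<close>

lemma irreducible_exterior_power_rep:
  assumes irr: "irreducible_rep K (exterior_power K V m) G (exterior_power_rep K V m \<rho>)"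
    and \<rho>: "\<And>g. g \<in> carrier G \<Longrightarrow> \<rho> g \<in> module_hom K V V"
    and U: "submodule K U (free_space K (tuples V m))" "wedge_kernel K V m \<subseteq> U"
    and inv: "\<And>g x. g \<in> carrier G \<Longrightarrow> x \<in> U \<Longrightarrow> free_map K (tuples V m) (map (\<rho> g)) x \<in> U"
  shows "U = wedge_kernel K V m \<or> U = carrier (free_space K (tuples V m))"
proof -
  let ?F = "free_space K (tuples V m)" and ?N = "wedge_kernel K V m" and ?E = "exterior_power K V m"
  let ?\<pi> = "\<lambda>x. ?N +>\<^bsub>?F\<^esub> x"
  interpret F: module K ?F by (rule module_free_space)
  interpret U: submodule K U ?F by (rule U)
  note N = submodule_wedge_kernel[of m]
  have Ec: "carrier ?E = ?\<pi> ` carrier ?F" "\<zero>\<^bsub>?E\<^esub> = ?N"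
    unfolding exterior_power_def by (simp_all add: F.quotient_space_simps[OF N])
  have "exterior_power_rep K V m \<rho> g ` ?\<pi> ` U \<subseteq> ?\<pi> ` U" if g: "g \<in> carrier G" for g
  proof clarify
    fix x assume x: "x \<in> U"
    then have xc: "x \<in> carrier ?F" using U.subset by auto
    have mt: "map (\<rho> g) \<in> tuples V m \<rightarrow> tuples V m"
      by (rule map_tuples[OF module_hom_closed[OF \<rho>[OF g]]])
    \<comment> \<open>By \<open>coset_map\<close>, the union over representatives is the single
      coset of the transported \<open>x\<close>.\<close>
    have "exterior_power_rep K V m \<rho> g (?\<pi> x) = ?\<pi> (free_map K (tuples V m) (map (\<rho> g)) x)"
      unfolding exterior_power_rep_def exterior_power_map_def
      using F.coset_map[OF N free_map_hom[OF mt] free_map_wedge_kernel[OF \<rho>[OF g]] xc] xc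
      by (simp only: Ec restrict_apply imageI if_True)
    with inv[OF g x] show "exterior_power_rep K V m \<rho> g (?\<pi> x) \<in> ?\<pi> ` U" by simp
  qed
  moreover have "subspace K (?\<pi> ` U) ?E"
    unfolding exterior_power_def
    by (intro subspace.intro vectorspace.intro F.module_quotient_space F.submodule_quotient_space N U field_axioms)
  ultimately have "invariant_subspace K ?E G (exterior_power_rep K V m \<rho>) (?\<pi> ` U)"
    by (simp add: invariant_subspace_def)
  with irr have "?\<pi> ` U = {?N} \<or> ?\<pi> ` U = ?\<pi> ` carrier ?F"
    by (simp add: irreducible_rep_def Ec)
  then show ?thesis
  proof
    assume a: "?\<pi> ` U = {?N}"
    have "U \<subseteq> ?N"
    proof
      fix x assume x: "x \<in> U"
      have "?\<pi> x = ?N" using a x by blast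
      \<comment> \<open>The kernel is the coset of zero, so \<open>?\<pi> x\<close> lies in the
        image of \<open>?N\<close>; \<open>coset_mem_image\<close>, with \<open>?N\<close> in the
        role of \<open>U\<close>, then gives membership of \<open>x\<close>.\<close>
      also have "\<dots> = ?\<pi> \<zero>\<^bsub>?F\<^esub>" using F.quotient_space_zero[OF N] ..
      finally have "?\<pi> x \<in> ?\<pi> ` ?N" using submodule.zero_closed[OF N] by (rule image_eqI)
      then show "x \<in> ?N" using F.coset_mem_image[OF N N subset_refl] x U.subset by auto
    qed
    with U(2) show ?thesis by auto
  next
    assume a: "?\<pi> ` U = ?\<pi> ` carrier ?F"
    have "carrier ?F \<subseteq> U"
    proof
      fix x assume x: "x \<in> carrier ?F"
      then have "?\<pi> x \<in> ?\<pi> ` U" by (simp add: a)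
      then show "x \<in> U" by (rule F.coset_mem_image[OF N U x])
    qed
    with U.subset show ?thesis by auto
  qed
qed

end

section \<open>Alternating forms\<close>

context vectorspace
begin

definition linear_form :: "('c \<Rightarrow> 'a) \<Rightarrow> bool" where
  "linear_form \<phi> \<longleftrightarrow> \<phi> \<in> carrier V \<rightarrow> carrier K
    \<and> (\<forall>v\<in>carrier V. \<forall>w\<in>carrier V. \<phi> (v \<oplus>\<^bsub>V\<^esub> w) = \<phi> v \<oplus>\<^bsub>K\<^esub> \<phi> w)
    \<and> (\<forall>c\<in>carrier K. \<forall>v\<in>carrier V. \<phi> (c \<odot>\<^bsub>V\<^esub> v) = c \<otimes>\<^bsub>K\<^esub> \<phi> v)"

definition alternating_form :: "nat \<Rightarrow> ('c list \<Rightarrow> 'a) \<Rightarrow> bool" where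
  "alternating_form m D \<longleftrightarrow> D \<in> tuples V m \<rightarrow> carrier K
    \<and> (\<forall>xs\<in>tuples V m. \<forall>i<m. \<forall>v\<in>carrier V. \<forall>w\<in>carrier V.
          D (xs[i := v \<oplus>\<^bsub>V\<^esub> w]) = D (xs[i := v]) \<oplus>\<^bsub>K\<^esub> D (xs[i := w]))
    \<and> (\<forall>xs\<in>tuples V m. \<forall>i<m. \<forall>c\<in>carrier K. \<forall>v\<in>carrier V.
          D (xs[i := c \<odot>\<^bsub>V\<^esub> v]) = c \<otimes>\<^bsub>K\<^esub> D (xs[i := v]))
    \<and> (\<forall>xs\<in>tuples V m. \<forall>i j. i < j \<and> j < m \<and> xs ! i = xs ! j \<longrightarrow> D xs = \<zero>\<^bsub>K\<^esub>)"

lemma alternating_formD: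
  assumes "alternating_form m D"
  shows "D \<in> tuples V m \<rightarrow> carrier K"
    and "xs \<in> tuples V m \<Longrightarrow> i < m \<Longrightarrow> v \<in> carrier V \<Longrightarrow> w \<in> carrier V \<Longrightarrow>
      D (xs[i := v \<oplus>\<^bsub>V\<^esub> w]) = D (xs[i := v]) \<oplus>\<^bsub>K\<^esub> D (xs[i := w])"
    and "xs \<in> tuples V m \<Longrightarrow> i < m \<Longrightarrow> c \<in> carrier K \<Longrightarrow> v \<in> carrier V \<Longrightarrow>
      D (xs[i := c \<odot>\<^bsub>V\<^esub> v]) = c \<otimes>\<^bsub>K\<^esub> D (xs[i := v])"
    and "xs \<in> tuples V m \<Longrightarrow> i < m \<Longrightarrow> j < m \<Longrightarrow> i \<noteq> j \<Longrightarrow> xs ! i = xs ! j \<Longrightarrow> D xs = \<zero>\<^bsub>K\<^esub>"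
  using assms unfolding alternating_form_def by (simp, simp, simp, metis nat_neq_iff)

lemma lin_ext_minus:
  assumes f: "f \<in> carrier (free_space K S)" and g: "g \<in> carrier (free_space K S)"
    and D: "D \<in> S \<rightarrow> carrier K"
  shows "lin_ext S D (f \<ominus>\<^bsub>free_space K S\<^esub> g) = lin_ext S D f \<ominus>\<^bsub>K\<^esub> lin_ext S D g"
proof -
  interpret F: module K "free_space K S" by (rule module_free_space)
  have "f \<ominus>\<^bsub>free_space K S\<^esub> g = f \<oplus>\<^bsub>free_space K S\<^esub> (\<ominus>\<^bsub>K\<^esub> \<one>\<^bsub>K\<^esub>) \<odot>\<^bsub>free_space K S\<^esub> g"
    using F.smult_minus_1[OF g] by (simp add: a_minus_def)
  then show ?thesis
    using f g lin_ext_closed[OF g D]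
    by (simp add: lin_ext_add[OF _ _ D] lin_ext_smult[OF _ _ D] F.smult_closed a_minus_def R.l_minus)
qed

text \<open>On the three kinds of relations, additivity, homogeneity and the alternating condition
  give zero, and the kernel is their span. Hence an alternating form descends to a functional on the
  exterior power.\<close>

lemma lin_ext_wedge_kernel:
  assumes D: "alternating_form m D" and f: "f \<in> wedge_kernel K V m"
  shows "lin_ext (tuples V m) D f = \<zero>\<^bsub>K\<^esub>"
proof -
  let ?F = "free_space K (tuples V m)" and ?e = "free_gen K (tuples V m)"
  let ?U = "{f \<in> carrier ?F. lin_ext (tuples V m) D f = \<zero>\<^bsub>K\<^esub>}"
  interpret F: module K ?F by (rule module_free_space)
  note Dc = alternating_formD(1)[OF D]
  have e: "?e xs \<in> carrier ?F" "lin_ext (tuples V m) D (?e xs) = D xs" "D xs \<in> carrier K"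
    if "xs \<in> tuples V m" for xs
    using free_gen_closed[OF that] lin_ext_free_gen[OF that Dc] funcset_mem[OF Dc that] by auto
  note lin = lin_ext_minus[OF _ _ Dc] lin_ext_add[OF _ _ Dc] lin_ext_smult[OF _ _ Dc]
  have "wedge_relations K V m \<subseteq> ?U"
  proof
    fix r assume r: "r \<in> wedge_relations K V m"
    then have "lin_ext (tuples V m) D r = \<zero>\<^bsub>K\<^esub>"
    proof (cases rule: wedge_relations_cases)
      case (add xs i v w)
      then show ?thesis
        using alternating_formD(2)[OF D add(1-4)] by (simp add: lin e update_tuples)
    next
      case (smult xs i c v)
      then show ?thesis
        using alternating_formD(3)[OF D smult(1-4)] by (simp add: lin e update_tuples)
    next
      case (alt xs i j)
      then show ?thesis
        using alternating_formD(4)[OF D alt(1), of i j] by (simp add: e)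
    qed
    with r show "r \<in> ?U" using wedge_relations_subset by auto
  qed
  from wedge_kernel_subset[OF submodule_lin_ext_ker[OF Dc] this] f show ?thesis by auto
qed

text \<open>Mapping a linear \<open>T\<close> over a list respects linear combinations in one slot
  and equality of entries. With \<open>T = \<rho> g\<close> this yields the translates of a form by
  the group.\<close>

lemma alternating_form_comp:
  assumes D: "alternating_form m D" and T: "T \<in> module_hom K V V"
  shows "alternating_form m (D \<circ> map T)"
proof -
  have Tc: "T \<in> carrier V \<rightarrow> carrier V" by (rule module_hom_closed[OF T])
  have tup: "map T xs \<in> tuples V m" if "xs \<in> tuples V m" for xs
    using funcset_mem[OF map_tuples[OF Tc] that] .
  have nth: "map T xs ! i = T (xs ! i)" if "xs \<in> tuples V m" "i < m" for xs i
    using that by (simp add: tuples_def)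
  show ?thesis
    unfolding alternating_form_def
  proof (intro conjI ballI allI impI)
    show "D \<circ> map T \<in> tuples V m \<rightarrow> carrier K"
      using tup alternating_formD(1)[OF D] by (simp add: Pi_iff)
  next
    fix xs i v w assume "xs \<in> tuples V m" "i < m" "v \<in> carrier V" "w \<in> carrier V"
    then show "(D \<circ> map T) (xs[i := v \<oplus>\<^bsub>V\<^esub> w]) = (D \<circ> map T) (xs[i := v]) \<oplus>\<^bsub>K\<^esub> (D \<circ> map T) (xs[i := w])"
      using tup Tc by (simp add: map_update module_hom_add[OF T] alternating_formD(2)[OF D] Pi_iff)
  next
    fix xs i c v assume "xs \<in> tuples V m" "i < m" "c \<in> carrier K" "v \<in> carrier V"
    then show "(D \<circ> map T) (xs[i := c \<odot>\<^bsub>V\<^esub> v]) = c \<otimes>\<^bsub>K\<^esub> (D \<circ> map T) (xs[i := v])"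
      using tup Tc by (simp add: map_update module_hom_smult[OF T] alternating_formD(3)[OF D] Pi_iff)
  next
    fix xs i j assume "xs \<in> tuples V m" "i < j \<and> j < m \<and> xs ! i = xs ! j"
    then show "(D \<circ> map T) xs = \<zero>\<^bsub>K\<^esub>"
      using tup nth[of xs i] nth[of xs j] alternating_formD(4)[OF D, of "map T xs" i j] by simp
  qed
qed

lemma alternating_form_finsum:
  assumes D: "alternating_form m D" and xs: "xs \<in> tuples V m" and i: "i < m"
    and A: "finite A" "x \<in> A \<rightarrow> carrier V" "c \<in> A \<rightarrow> carrier K"
  shows "D (xs[i := (\<Oplus>\<^bsub>V\<^esub>j\<in>A. c j \<odot>\<^bsub>V\<^esub> x j)]) = (\<Oplus>\<^bsub>K\<^esub>j\<in>A. c j \<otimes>\<^bsub>K\<^esub> D (xs[i := x j]))"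
  using A
proof (induction A rule: finite_induct)
  case empty
  \<comment> \<open>The empty combination puts zero into slot \<open>i\<close>; homogeneity with the
    scalar zero evaluates it.\<close>
  have "D (xs[i := \<zero>\<^bsub>V\<^esub>]) = \<zero>\<^bsub>K\<^esub>"
    using alternating_formD(3)[OF D xs i R.zero_closed M.zero_closed]
      funcset_mem[OF alternating_formD(1)[OF D] update_tuples[OF xs M.zero_closed]] by simp
  then show ?case by simp
next
  case (insert a A)
  have cl: "D (xs[i := v]) \<in> carrier K" if "v \<in> carrier V" for v
    by (rule funcset_mem[OF alternating_formD(1)[OF D] update_tuples[OF xs that]])
  from insert show ?case
    by (simp add: Pi_iff alternating_formD[OF D] xs i cl)
qed

text \<open>Expanding slot \<open>k\<close>, every summand with \<open>j \<noteq> k\<close> contains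
  \<open>xs ! j\<close> twice and vanishes; only \<open>j = k\<close> survives. So if the form
  vanishes after the substitution but not on \<open>xs\<close>, then \<open>c k\<close> is
  zero.\<close>

lemma alternating_form_dependent:
  assumes D: "alternating_form m D" and xs: "xs \<in> tuples V m" and k: "k < m"
    and c: "c \<in> {..<m} \<rightarrow> carrier K"
  shows "D (xs[k := (\<Oplus>\<^bsub>V\<^esub>j\<in>{..<m}. c j \<odot>\<^bsub>V\<^esub> xs ! j)]) = c k \<otimes>\<^bsub>K\<^esub> D xs"
proof -
  have x: "xs ! j \<in> carrier V" if "j < m" for j using xs that by (auto simp: tuples_def)
  have cl: "D xs \<in> carrier K" by (rule funcset_mem[OF alternating_formD(1)[OF D] xs])
  have "D (xs[k := xs ! j]) = (if j = k then D xs else \<zero>\<^bsub>K\<^esub>)" if "j < m" for j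
  proof (cases "j = k")
    case False
    with k that xs show ?thesis
      using alternating_formD(4)[OF D update_tuples[OF xs x[OF that]], of j k]
      by (auto simp: tuples_def)
  qed simp
  then have "(\<Oplus>\<^bsub>K\<^esub>j\<in>{..<m}. c j \<otimes>\<^bsub>K\<^esub> D (xs[k := xs ! j])) =
      (\<Oplus>\<^bsub>K\<^esub>j\<in>{..<m}. if k = j then c j \<otimes>\<^bsub>K\<^esub> D xs else \<zero>\<^bsub>K\<^esub>)"
    using c cl by (intro R.finsum_cong') (auto simp: Pi_iff)
  also have "\<dots> = c k \<otimes>\<^bsub>K\<^esub> D xs"
    using R.finsum_singleton[of k "{..<m}" "\<lambda>j. c j \<otimes>\<^bsub>K\<^esub> D xs"] k c cl by (auto simp: Pi_iff)
  finally show ?thesis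
    using alternating_form_finsum[OF D xs k, of "{..<m}" "(!) xs" c] c x by (simp add: Pi_iff)
qed

section \<open>Determinants of linear forms as alternating forms\<close>

definition det_term :: "(nat \<Rightarrow> 'c \<Rightarrow> 'a) \<Rightarrow> nat \<Rightarrow> (nat \<Rightarrow> nat) \<Rightarrow> 'c list \<Rightarrow> 'a" where
  "det_term f m p xs = (\<Otimes>\<^bsub>K\<^esub>j\<in>{..<m}. f (p j) (xs ! j))"

text \<open>The Leibniz formula for the matrix \<open>f i (xs ! j)\<close>, split by parity so that exchanging two
  columns becomes a reindexing of one sum into the other.\<close>
definition det_form :: "(nat \<Rightarrow> 'c \<Rightarrow> 'a) \<Rightarrow> nat \<Rightarrow> 'c list \<Rightarrow> 'a" where
  "det_form f m xs = (\<Oplus>\<^bsub>K\<^esub>p\<in>{p. p permutes {..<m} \<and> evenperm p}. det_term f m p xs)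
     \<ominus>\<^bsub>K\<^esub> (\<Oplus>\<^bsub>K\<^esub>p\<in>{p. p permutes {..<m} \<and> \<not> evenperm p}. det_term f m p xs)"

context
  fixes f :: "nat \<Rightarrow> 'c \<Rightarrow> 'a" and m :: nat
  assumes f: "\<And>i. i < m \<Longrightarrow> linear_form (f i)"
begin

lemma form_closed: "i < m \<Longrightarrow> v \<in> carrier V \<Longrightarrow> f i v \<in> carrier K"
  using f by (auto simp: linear_form_def Pi_iff)

lemma entry_closed: "p permutes {..<m} \<Longrightarrow> xs \<in> tuples V m \<Longrightarrow> j < m \<Longrightarrow> f (p j) (xs ! j) \<in> carrier K"
  using permutes_in_image[of p "{..<m}" j] by (intro form_closed) (auto simp: tuples_def)

lemma det_term_closed: "p permutes {..<m} \<Longrightarrow> xs \<in> tuples V m \<Longrightarrow> det_term f m p xs \<in> carrier K"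
  unfolding det_term_def by (intro finprod_closed) (simp add: entry_closed)

text \<open>Only the factor at \<open>k\<close> sees the new entry. Linearity of a Leibniz term in
  one slot thus reduces to linearity of a single form.\<close>

lemma det_term_update:
  assumes p: "p permutes {..<m}" and xs: "xs \<in> tuples V m" and k: "k < m" and v: "v \<in> carrier V"
  shows "det_term f m p (xs[k := v]) = f (p k) v \<otimes>\<^bsub>K\<^esub> (\<Otimes>\<^bsub>K\<^esub>j\<in>{..<m} - {k}. f (p j) (xs ! j))"
proof -
  have len: "length xs = m" using xs by (simp add: tuples_def)
  have pk: "p k < m" using permutes_in_image[OF p, of k] k by simp
  have "det_term f m p (xs[k := v]) = (\<Otimes>\<^bsub>K\<^esub>j\<in>insert k ({..<m} - {k}). f (p j) (xs[k := v] ! j))"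
    using k unfolding det_term_def by (simp add: insert_absorb)
  also have "\<dots> = f (p k) (xs[k := v] ! k) \<otimes>\<^bsub>K\<^esub> (\<Otimes>\<^bsub>K\<^esub>j\<in>{..<m} - {k}. f (p j) (xs[k := v] ! j))"
    using entry_closed[OF p update_tuples[OF xs v]] k by (intro finprod_insert) auto
  also have "(\<Otimes>\<^bsub>K\<^esub>j\<in>{..<m} - {k}. f (p j) (xs[k := v] ! j)) = (\<Otimes>\<^bsub>K\<^esub>j\<in>{..<m} - {k}. f (p j) (xs ! j))"
    using entry_closed[OF p xs] by (intro finprod_cong') auto
  finally show ?thesis using k len by simp
qed

lemma det_term_rest_closed:
  "p permutes {..<m} \<Longrightarrow> xs \<in> tuples V m \<Longrightarrow> (\<Otimes>\<^bsub>K\<^esub>j\<in>{..<m} - {k}. f (p j) (xs ! j)) \<in> carrier K"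
  by (intro finprod_closed) (simp add: entry_closed)

lemma det_term_add:
  assumes p: "p permutes {..<m}" and xs: "xs \<in> tuples V m" and k: "k < m"
    and v: "v \<in> carrier V" and w: "w \<in> carrier V"
  shows "det_term f m p (xs[k := v \<oplus>\<^bsub>V\<^esub> w]) = det_term f m p (xs[k := v]) \<oplus>\<^bsub>K\<^esub> det_term f m p (xs[k := w])"
proof -
  have pk: "p k < m" using permutes_in_image[OF p, of k] k by simp
  then have "f (p k) (v \<oplus>\<^bsub>V\<^esub> w) = f (p k) v \<oplus>\<^bsub>K\<^esub> f (p k) w"
    using f v w by (simp add: linear_form_def)
  then show ?thesis
    by (simp add: det_term_update[OF p xs k] v w l_distr form_closed[OF pk] det_term_rest_closed[OF p xs])
qed

lemma det_term_smult:
  assumes p: "p permutes {..<m}" and xs: "xs \<in> tuples V m" and k: "k < m"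
    and c: "c \<in> carrier K" and v: "v \<in> carrier V"
  shows "det_term f m p (xs[k := c \<odot>\<^bsub>V\<^esub> v]) = c \<otimes>\<^bsub>K\<^esub> det_term f m p (xs[k := v])"
proof -
  have pk: "p k < m" using permutes_in_image[OF p, of k] k by simp
  then have "f (p k) (c \<odot>\<^bsub>V\<^esub> v) = c \<otimes>\<^bsub>K\<^esub> f (p k) v"
    using f v c by (simp add: linear_form_def)
  then show ?thesis
    by (simp add: det_term_update[OF p xs k] v c m_assoc form_closed[OF pk] det_term_rest_closed[OF p xs])
qed

lemma det_term_zero:
  assumes p: "p permutes {..<m}" and xs: "xs \<in> tuples V m" and k: "k < m"
    and z: "f (p k) (xs ! k) = \<zero>\<^bsub>K\<^esub>"
  shows "det_term f m p xs = \<zero>\<^bsub>K\<^esub>"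
proof -
  have "xs ! k \<in> carrier V" using xs k by (auto simp: tuples_def)
  \<comment> \<open>Updating slot \<open>k\<close> by its own entry changes nothing, so the update
    formula exhibits the vanishing factor.\<close>
  from det_term_update[OF p xs k this] show ?thesis
    using z det_term_rest_closed[OF p xs] by simp
qed

text \<open>Reindexing the product along the transposition composes it with \<open>p\<close> and
  also exchanges two entries of the list, which changes nothing as these are equal.\<close>

lemma det_term_transpose:
  assumes p: "p permutes {..<m}" and xs: "xs \<in> tuples V m" and ij: "i < m" "j < m"
    and eq: "xs ! i = xs ! j"
  shows "det_term f m (p \<circ> transpose i j) xs = det_term f m p xs"
proof -
  have t: "transpose i j permutes {..<m}" by (rule permutes_swap_id) (use ij in auto)
  have "det_term f m p xs = (\<Otimes>\<^bsub>K\<^esub>k\<in>transpose i j ` {..<m}. f (p k) (xs ! k))"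
    by (simp add: det_term_def permutes_image[OF t])
  also have "\<dots> = (\<Otimes>\<^bsub>K\<^esub>k\<in>{..<m}. f (p (transpose i j k)) (xs ! transpose i j k))"
    using entry_closed[OF p xs] by (intro finprod_reindex) (auto simp: permutes_image[OF t] permutes_inj_on[OF t])
  moreover have "xs ! transpose i j k = xs ! k" for k
    using eq by (auto simp: transpose_def)
  ultimately show ?thesis by (simp add: det_term_def)
qed

lemma finite_perms: "finite {p. p permutes {..<m} \<and> Q p}"
  by (rule finite_subset[OF _ finite_permutations[of "{..<m}"]]) auto

lemma det_sum_closed: "xs \<in> tuples V m \<Longrightarrow>
    (\<Oplus>\<^bsub>K\<^esub>p\<in>{p. p permutes {..<m} \<and> Q p}. det_term f m p xs) \<in> carrier K"
  by (intro R.finsum_closed) (simp add: det_term_closed)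

lemma alternating_form_det_form: "alternating_form m (det_form f m)"
  unfolding alternating_form_def
proof (intro conjI ballI allI impI)
  show "det_form f m \<in> tuples V m \<rightarrow> carrier K"
    by (simp add: det_form_def det_sum_closed)
next
  fix xs k v w assume a: "xs \<in> tuples V m" "k < m" "v \<in> carrier V" "w \<in> carrier V"
  \<comment> \<open>An arbitrary predicate \<open>Q\<close> covers the even and the odd sum at
    once.\<close>
  have s: "(\<Oplus>\<^bsub>K\<^esub>p\<in>{p. p permutes {..<m} \<and> Q p}. det_term f m p (xs[k := v \<oplus>\<^bsub>V\<^esub> w])) =
     (\<Oplus>\<^bsub>K\<^esub>p\<in>{p. p permutes {..<m} \<and> Q p}. det_term f m p (xs[k := v])) \<oplus>\<^bsub>K\<^esub>
     (\<Oplus>\<^bsub>K\<^esub>p\<in>{p. p permutes {..<m} \<and> Q p}. det_term f m p (xs[k := w]))" for Q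
    using a by (subst R.add.finprod_multf[symmetric])
      (auto simp: det_term_closed update_tuples det_term_add simp del: R.add.finprod_multf
        intro!: R.finsum_cong')
  have cl: "(\<Oplus>\<^bsub>K\<^esub>p\<in>{p. p permutes {..<m} \<and> Q p}. det_term f m p (xs[k := u])) \<in> carrier K"
    if "u \<in> carrier V" for Q u
    by (rule det_sum_closed[OF update_tuples[OF a(1) that]])
  show "det_form f m (xs[k := v \<oplus>\<^bsub>V\<^esub> w]) = det_form f m (xs[k := v]) \<oplus>\<^bsub>K\<^esub> det_form f m (xs[k := w])"
    unfolding det_form_def s
    using cl[OF a(3)] cl[OF a(4)]
    by (simp add: a_minus_def R.minus_add R.a_ac)
next
  fix xs k c v assume a: "xs \<in> tuples V m" "k < m" "c \<in> carrier K" "v \<in> carrier V"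
  have s: "(\<Oplus>\<^bsub>K\<^esub>p\<in>{p. p permutes {..<m} \<and> Q p}. det_term f m p (xs[k := c \<odot>\<^bsub>V\<^esub> v])) =
     c \<otimes>\<^bsub>K\<^esub> (\<Oplus>\<^bsub>K\<^esub>p\<in>{p. p permutes {..<m} \<and> Q p}. det_term f m p (xs[k := v]))" for Q
    using a finite_perms[of Q] by (subst R.finsum_rdistr)
      (auto simp: det_term_closed update_tuples det_term_smult intro!: R.finsum_cong')
  have cl: "(\<Oplus>\<^bsub>K\<^esub>p\<in>{p. p permutes {..<m} \<and> Q p}. det_term f m p (xs[k := v])) \<in> carrier K" for Q
    by (rule det_sum_closed[OF update_tuples[OF a(1,4)]])
  show "det_form f m (xs[k := c \<odot>\<^bsub>V\<^esub> v]) = c \<otimes>\<^bsub>K\<^esub> det_form f m (xs[k := v])"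
    unfolding det_form_def s using cl a(3) by (simp add: a_minus_def R.r_distr R.r_minus)
next
  fix xs i j assume xs: "xs \<in> tuples V m" and "i < j \<and> j < m \<and> xs ! i = xs ! j"
  then have ij: "i < m" "j < m" "i \<noteq> j" "xs ! i = xs ! j" by auto
  let ?t = "transpose i j" and ?E = "{p. p permutes {..<m} \<and> evenperm p}"
    and ?O = "{p. p permutes {..<m} \<and> \<not> evenperm p}"
  have t: "?t permutes {..<m}" by (rule permutes_swap_id) (use ij in auto)
  have perm: "permutation p" if "p permutes {..<m}" for p
    using that by (auto simp: permutation_permutes)
  have ev: "evenperm (p \<circ> ?t) \<longleftrightarrow> \<not> evenperm p" if "p permutes {..<m}" for p
    using evenperm_comp[OF perm[OF that] perm[OF t]] ij by (simp add: evenperm_swap)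
  have inv: "p \<circ> ?t \<circ> ?t = p" for p :: "nat \<Rightarrow> nat" by (simp add: comp_assoc)
  \<comment> \<open>Composition with a transposition reverses parity and is its own inverse, so it
    matches even with odd permutations. Matched terms are equal, and the two sums cancel.\<close>
  have img: "(\<lambda>p. p \<circ> ?t) ` ?E = ?O"
  proof (intro subset_antisym subsetI)
    fix p assume "p \<in> ?O"
    then have "p \<circ> ?t \<in> ?E" using permutes_compose[OF t] ev by auto
    then show "p \<in> (\<lambda>p. p \<circ> ?t) ` ?E" using inv[of p] by (intro image_eqI[where x = "p \<circ> ?t"]) auto
  qed (use permutes_compose[OF t] ev in auto)
  have inj: "inj_on (\<lambda>p. p \<circ> ?t) ?E" by (rule inj_on_inverseI[where g = "\<lambda>p. p \<circ> ?t"]) (rule inv)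
  have "(\<Oplus>\<^bsub>K\<^esub>p\<in>?O. det_term f m p xs) = (\<Oplus>\<^bsub>K\<^esub>p\<in>?E. det_term f m (p \<circ> ?t) xs)"
    unfolding img[symmetric]
    by (rule R.finsum_reindex[OF _ inj]) (use img xs det_term_closed in auto)
  also have "\<dots> = (\<Oplus>\<^bsub>K\<^esub>p\<in>?E. det_term f m p xs)"
    using det_term_closed[OF _ xs] det_term_transpose[OF _ xs ij(1,2,4)] by (intro R.finsum_cong') auto
  finally show "det_form f m xs = \<zero>\<^bsub>K\<^esub>"
    using det_sum_closed[OF xs] by (simp add: det_form_def)
qed

lemma det_form_zero:
  assumes xs: "xs \<in> tuples V m" and k: "k < m" and z: "\<And>i. i < m \<Longrightarrow> f i (xs ! k) = \<zero>\<^bsub>K\<^esub>"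
  shows "det_form f m xs = \<zero>\<^bsub>K\<^esub>"
proof -
  have "det_term f m p xs = \<zero>\<^bsub>K\<^esub>" if p: "p permutes {..<m}" for p
    using det_term_zero[OF p xs k z] permutes_in_image[OF p, of k] k by simp
  then have "(\<Oplus>\<^bsub>K\<^esub>p\<in>{p. p permutes {..<m} \<and> Q p}. det_term f m p xs) = \<zero>\<^bsub>K\<^esub>" for Q
    by (intro R.add.finprod_one_eqI) simp
  then show ?thesis by (simp add: det_form_def)
qed

text \<open>A permutation other than \<open>id\<close> moves some \<open>k\<close> and picks up an
  off-diagonal zero there, while \<open>id\<close>, which is even, contributes one.\<close>

lemma det_form_dual:
  assumes xs: "xs \<in> tuples V m"
    and dual: "\<And>i j. i < m \<Longrightarrow> j < m \<Longrightarrow> f i (xs ! j) = (if i = j then \<one>\<^bsub>K\<^esub> else \<zero>\<^bsub>K\<^esub>)"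
  shows "det_form f m xs = \<one>\<^bsub>K\<^esub>"
proof -
  have t: "det_term f m p xs = (if id = p then \<one>\<^bsub>K\<^esub> else \<zero>\<^bsub>K\<^esub>)" if p: "p permutes {..<m}" for p
  proof (cases "p = id")
    case True
    have "det_term f m p xs = \<one>\<^bsub>K\<^esub>"
      unfolding det_term_def True by (rule finprod_one_eqI) (simp add: dual)
    with True show ?thesis by simp
  next
    case False
    then obtain k where k: "p k \<noteq> k" by (auto simp: fun_eq_iff)
    then have "k < m" using p by (auto simp: permutes_def)
    with k have "f (p k) (xs ! k) = \<zero>\<^bsub>K\<^esub>" using dual[of "p k" k] permutes_in_image[OF p, of k] by simp
    from det_term_zero[OF p xs \<open>k < m\<close> this] False show ?thesis by simp
  qed
  have "(\<Oplus>\<^bsub>K\<^esub>p\<in>{p. p permutes {..<m} \<and> evenperm p}. det_term f m p xs) =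
     (\<Oplus>\<^bsub>K\<^esub>p\<in>{p. p permutes {..<m} \<and> evenperm p}. if id = p then \<one>\<^bsub>K\<^esub> else \<zero>\<^bsub>K\<^esub>)"
    using t by (intro R.finsum_cong') auto
  also have "\<dots> = \<one>\<^bsub>K\<^esub>"
    by (rule R.finsum_singleton) (auto simp: finite_perms permutes_id)
  moreover have "(\<Oplus>\<^bsub>K\<^esub>p\<in>{p. p permutes {..<m} \<and> \<not> evenperm p}. det_term f m p xs) = \<zero>\<^bsub>K\<^esub>"
    using t by (intro R.add.finprod_one_eqI) (auto simp: evenperm_id)
  ultimately show ?thesis by (simp add: det_form_def a_minus_def)
qed
end

end

section \<open>Subspaces, bases and coordinates\<close>

context vectorspace
begin

lemma submodule_subspace: "submodule K W V \<Longrightarrow> subspace K W V"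
  by (rule subspace.intro[OF vectorspace_axioms])

text \<open>Steinitz exchange against a finite basis adds at most \<open>dim - card A\<close>
  vectors to \<open>A\<close> to obtain a spanning set, and a spanning set of at most
  \<open>dim\<close> elements is a basis.\<close>

lemma extend_to_basis:
  assumes fd: fin_dim and A: "A \<subseteq> carrier V" "lin_indpt A"
  obtains C where "A \<subseteq> C" "finite C" "basis C"
proof -
  have fA: "finite A" by (rule fin_dim_li_fin[OF fd A(2,1)])
  obtain \<beta> where \<beta>: "finite \<beta>" "basis \<beta>" using finite_basis_exists[OF fd] by auto
  then have \<beta>': "\<beta> \<subseteq> carrier V" "span \<beta> = carrier V" "dim = card \<beta>"
    using dim_basis by (auto simp: basis_def)
  then obtain C where C: "finite C" "C \<subseteq> carrier V" "int (card C) \<le> int (card \<beta>) - int (card A)"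
      "span (A \<union> C) = span \<beta>"
    using replacement[OF fA \<beta>(1) \<beta>'(1) A(2)] A(1) by auto
  have "basis (A \<union> C)"
  proof (rule dim_gen_is_basis)
    show "card (A \<union> C) \<le> dim" using card_Un_le[of A C] C(3) \<beta>'(3) by linarith
  qed (use fA C A \<beta>' in auto)
  with that[of "A \<union> C"] fA C show ?thesis by auto
qed

text \<open>Independent subsets of \<open>W\<close> have at most \<open>dim\<close> elements, so a
  maximal one exists and is a basis of \<open>W\<close>. Span and independence of subsets of
  \<open>W\<close> do not change on passing to \<open>V\<close>.\<close>

lemma subspace_basis:
  assumes fd: fin_dim and W: "subspace K W V"
  obtains B where "B \<subseteq> W" "finite B" "lin_indpt B" "span B = W" "card B = vectorspace.dim K (vs W)"
proof -
  interpret S: vectorspace K "vs W" by (rule subspace_is_vs[OF W])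
  have sm: "submodule K W V" using W by simp
  have Wc: "W \<subseteq> carrier V" using submodule.subset[OF sm] .
  note dep = span_li_not_depend[OF _ sm]
  let ?P = "\<lambda>B. B \<subseteq> carrier (vs W) \<and> S.lin_indpt B"
  have "finite B \<and> card B \<le> dim" if "?P B" for B
    using that dep(2)[of B] li_le_dim[OF fd, of B] Wc by auto
  moreover have "?P {}" by (simp add: S.lin_dep_def)
  ultimately obtain B where B: "finite B" "maximal B ?P"
    using maximal_exists[of ?P dim "{}"] by blast
  then have b: "S.basis B" by (intro S.max_li_is_basis)
  then have BW: "B \<subseteq> W" by (simp add: S.basis_def)
  show ?thesis
    by (rule that[of B]) (use b B BW S.dim_basis[OF B(1) b] dep[OF BW] in \<open>auto simp: S.basis_def\<close>)
qed

lemma dim_span: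
  assumes B: "finite B" "B \<subseteq> carrier V" "lin_indpt B"
  shows "vectorspace.dim K (vs (span B)) = card B"
proof -
  have W: "subspace K (span B) V" by (rule span_is_subspace[OF B(2)])
  interpret S: vectorspace K "vs (span B)" by (rule subspace_is_vs[OF W])
  have sm: "submodule K (span B) V" using W by simp
  have BW: "B \<subseteq> span B" by (rule in_own_span[OF B(2)])
  have "S.basis B" using span_li_not_depend[OF BW sm] BW B(3) by (simp add: S.basis_def)
  from S.dim_basis[OF B(1) this] show ?thesis .
qed

lemma subspace_fin_dim:
  assumes fd: fin_dim and W: "subspace K W V"
  shows "vectorspace.fin_dim K (vs W)"
proof -
  interpret S: vectorspace K "vs W" by (rule subspace_is_vs[OF W])
  obtain B where B: "B \<subseteq> W" "finite B" "span B = W" by (rule subspace_basis[OF fd W])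
  have sm: "submodule K W V" using W by simp
  from span_li_not_depend(1)[OF B(1) sm] B show ?thesis unfolding S.fin_dim_def by auto
qed

text \<open>Bases of \<open>U\<close> and \<open>W\<close> are disjoint and jointly independent
  because the intersection is zero; by the count of elements their union is a basis of
  \<open>V\<close>.\<close>

lemma complementary_dims:
  assumes fd: fin_dim and U: "subspace K U V" and W: "subspace K W V"
    and disj: "U \<inter> W = {\<zero>\<^bsub>V\<^esub>}"
    and dims: "vectorspace.dim K (vs U) + vectorspace.dim K (vs W) = dim"
  shows "submodule_sum U W = carrier V"
proof -
  obtain A where A: "A \<subseteq> U" "finite A" "lin_indpt A" "span A = U" "card A = vectorspace.dim K (vs U)"
    by (rule subspace_basis[OF fd U])
  obtain B where B: "B \<subseteq> W" "finite B" "lin_indpt B" "span B = W" "card B = vectorspace.dim K (vs W)"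
    by (rule subspace_basis[OF fd W])
  have Uc: "U \<subseteq> carrier V" and Wc: "W \<subseteq> carrier V"
    using U W submodule.subset is_module by blast+
  have AB: "A \<union> B \<subseteq> carrier V" "A \<subseteq> carrier V" "B \<subseteq> carrier V" using A(1) B(1) Uc Wc by auto
  have "A \<inter> B \<subseteq> {\<zero>\<^bsub>V\<^esub>}" using A(1) B(1) disj by blast
  with vs_zero_lin_dep[OF AB(2) A(3)] have int: "A \<inter> B = {}" by auto
  have mem: "lincomb a A \<in> U" "lincomb a B \<in> W" if "a \<in> A \<union> B \<rightarrow> carrier K" for a
    using that A(2,4) B(2,4) unfolding span_def by auto
  have "lin_indpt (A \<union> B)"
  proof (rule finite_lin_indpt2)
    fix a assume a: "a \<in> A \<union> B \<rightarrow> carrier K" "lincomb a (A \<union> B) = \<zero>\<^bsub>V\<^esub>"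
    have cl: "lincomb a A \<in> carrier V" "lincomb a B \<in> carrier V" using mem[OF a(1)] Uc Wc by auto
    have sum: "lincomb a A \<oplus>\<^bsub>V\<^esub> lincomb a B = \<zero>\<^bsub>V\<^esub>"
      using lincomb_union[OF AB(2,3) int A(2) B(2) a(1)] a(2) by simp
    \<comment> \<open>The part over \<open>A\<close> is the negative of the part over
      \<open>B\<close>, hence lies in both subspaces and is zero.\<close>
    then have "lincomb a A = \<ominus>\<^bsub>V\<^esub> lincomb a B" using cl M.minus_equality by metis
    also have "\<dots> = (\<ominus>\<^bsub>K\<^esub> \<one>\<^bsub>K\<^esub>) \<odot>\<^bsub>V\<^esub> lincomb a B" using smult_minus_1[OF cl(2)] by simp
    also have "\<dots> \<in> W"
      using submodule.smult_closed[OF is_module[OF W] _ mem(2)[OF a(1)]] by simp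
    finally have "lincomb a A = \<zero>\<^bsub>V\<^esub>" using mem(1)[OF a(1)] disj by auto
    moreover from this sum have "lincomb a B = \<zero>\<^bsub>V\<^esub>" using cl by simp
    moreover have "a \<in> A \<rightarrow> carrier K" "a \<in> B \<rightarrow> carrier K" using a(1) by auto
    ultimately have "a \<in> A \<rightarrow> {\<zero>\<^bsub>K\<^esub>}" "a \<in> B \<rightarrow> {\<zero>\<^bsub>K\<^esub>}"
      using not_lindepD[OF A(3,2) subset_refl] not_lindepD[OF B(3,2) subset_refl] by auto
    then show "\<forall>v\<in>A \<union> B. a v = \<zero>\<^bsub>K\<^esub>" by auto
  qed (use A B AB in auto)
  moreover have "card (A \<union> B) = dim" using card_Un_disjoint[OF A(2) B(2) int] A(5) B(5) dims by simp
  ultimately have "basis (A \<union> B)" using A(2) B(2) AB by (intro dim_li_is_basis[OF fd]) auto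
  then have span: "span (A \<union> B) = carrier V" by (simp add: basis_def)
  show ?thesis
  proof (rule antisym)
    show "submodule_sum U W \<subseteq> carrier V" using Uc Wc by (auto simp: submodule_sum_def)
    show "carrier V \<subseteq> submodule_sum U W"
    proof
      fix v assume "v \<in> carrier V"
      then have "v \<in> span (A \<union> B)" by (simp add: span)
      then obtain a where a: "a \<in> A \<union> B \<rightarrow> carrier K" "lincomb a (A \<union> B) = v"
        using finite_in_span[OF _ AB(1)] A(2) B(2) by blast
      then have "v = lincomb a A \<oplus>\<^bsub>V\<^esub> lincomb a B"
        using lincomb_union[OF AB(2,3) int A(2) B(2) a(1)] by simp
      with mem[OF a(1)] show "v \<in> submodule_sum U W" by (auto simp: submodule_sum_def)
    qed
  qed
qed

section \<open>Coordinate forms and the determinant modulo a subspace\<close>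

lemma basis_coordinates:
  assumes C: "finite C" "basis C"
  shows "\<exists>\<kappa>. (\<forall>c\<in>C. linear_form (\<kappa> c)) \<and>
    (\<forall>c\<in>C. \<forall>d\<in>C. \<kappa> c d = (if c = d then \<one>\<^bsub>K\<^esub> else \<zero>\<^bsub>K\<^esub>))"
proof -
  have Cc: "C \<subseteq> carrier V" using C by (simp add: basis_def)
  have uniq: "\<exists>!a. a \<in> C \<rightarrow>\<^sub>E carrier K \<and> lincomb a C = v" if "v \<in> carrier V" for v
    using basis_criterion[OF C(1) Cc] C(2) that by blast
  \<comment> \<open>Coefficients are unique only among functions extensional on \<open>C\<close>;
    \<open>eq\<close> below handles arbitrary coefficient functions by restricting them.\<close>
  define a where "a v = (THE a. a \<in> C \<rightarrow>\<^sub>E carrier K \<and> lincomb a C = v)" for v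
  have a: "a v \<in> C \<rightarrow>\<^sub>E carrier K" "lincomb (a v) C = v" if "v \<in> carrier V" for v
    using theI'[OF uniq[OF that]] by (auto simp: a_def)
  have eq: "a v c = b c" if "b \<in> C \<rightarrow> carrier K" "lincomb b C = v" "c \<in> C" for v b c
  proof -
    have v: "v \<in> carrier V" using that Cc by auto
    have r: "restrict b C \<in> C \<rightarrow>\<^sub>E carrier K" using that by auto
    have "lincomb (restrict b C) C = v"
      using lincomb_restrict[OF Cc that(1), of "restrict b C"] that by simp
    with r have "a v = restrict b C" using uniq[OF v] a[OF v] by blast
    with that show ?thesis by simp
  qed
  have ac: "a v \<in> C \<rightarrow> carrier K" if "v \<in> carrier V" for v using a(1)[OF that] by auto
  show ?thesis
  proof (intro exI[of _ "\<lambda>c v. a v c"] conjI ballI)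
    show "linear_form (\<lambda>v. a v c)" if c: "c \<in> C" for c
      unfolding linear_form_def
    proof (intro conjI ballI)
      show "(\<lambda>v. a v c) \<in> carrier V \<rightarrow> carrier K" using ac c by auto
    next
      fix v w assume v: "v \<in> carrier V" and w: "w \<in> carrier V"
      show "a (v \<oplus>\<^bsub>V\<^esub> w) c = a v c \<oplus>\<^bsub>K\<^esub> a w c"
        using lincomb_sum[OF C(1) Cc ac[OF v] ac[OF w]] a v w ac c
        by (intro eq) (auto simp: Pi_iff)
    next
      fix k v assume k: "k \<in> carrier K" and v: "v \<in> carrier V"
      show "a (k \<odot>\<^bsub>V\<^esub> v) c = k \<otimes>\<^bsub>K\<^esub> a v c"
        using lincomb_smult[OF Cc ac[OF v] k] a v ac c k
        by (intro eq) (auto simp: Pi_iff)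
    qed
  next
    fix c d assume c: "c \<in> C" and d: "d \<in> C"
    have dc: "d \<in> carrier V" using d Cc by auto
    have "lincomb (\<lambda>c. if d = c then \<one>\<^bsub>K\<^esub> else \<zero>\<^bsub>K\<^esub>) C = (\<Oplus>\<^bsub>V\<^esub>c\<in>C. if d = c then c else \<zero>\<^bsub>V\<^esub>)"
      unfolding lincomb_def using Cc by (intro M.finsum_cong') auto
    also have "\<dots> = d" using M.finsum_singleton[OF d C(1), of "\<lambda>c. c"] Cc by auto
    finally show "a d c = (if c = d then \<one>\<^bsub>K\<^esub> else \<zero>\<^bsub>K\<^esub>)"
      using eq[of "\<lambda>c. if d = c then \<one>\<^bsub>K\<^esub> else \<zero>\<^bsub>K\<^esub>" d c] c by auto
  qed
qed

lemma lincomb_list_sum: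
  assumes "distinct xs" "set xs \<subseteq> carrier V" "a \<in> set xs \<rightarrow> carrier K"
  shows "lincomb a (set xs) = (\<Oplus>\<^bsub>V\<^esub>j\<in>{..<length xs}. a (xs ! j) \<odot>\<^bsub>V\<^esub> xs ! j)"
proof -
  have img: "set xs = (!) xs ` {..<length xs}" by (auto simp: set_conv_nth)
  have "inj_on ((!) xs) {..<length xs}" using assms(1) by (simp add: inj_on_nth)
  from M.finsum_reindex[OF _ this, of "\<lambda>v. a v \<odot>\<^bsub>V\<^esub> v"] assms(2,3)
  show ?thesis unfolding lincomb_def img by (auto simp: Pi_iff subset_iff set_conv_nth)
qed

text \<open>\<open>D\<close> is the determinant of the coordinates along \<open>bs\<close>, that is,
  of vectors modulo the span of \<open>C - set bs\<close>. If a combination of \<open>xs\<close>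
  lies in that span, putting it into slot \<open>j\<close> creates a zero column, whereas expansion
  gives \<open>c j\<close> times \<open>D xs\<close>.\<close>

lemma exists_separating_form:
  assumes C: "finite C" "basis C" and bs: "distinct bs" "set bs \<subseteq> C"
  obtains D where "alternating_form (length bs) D" "D bs = \<one>\<^bsub>K\<^esub>"
    "\<And>xs c j. xs \<in> tuples V (length bs) \<Longrightarrow> D xs \<noteq> \<zero>\<^bsub>K\<^esub> \<Longrightarrow> c \<in> {..<length bs} \<rightarrow> carrier K \<Longrightarrow>
      (\<Oplus>\<^bsub>V\<^esub>j\<in>{..<length bs}. c j \<odot>\<^bsub>V\<^esub> xs ! j) \<in> span (C - set bs) \<Longrightarrow> j < length bs \<Longrightarrow> c j = \<zero>\<^bsub>K\<^esub>"
proof -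
  have Cc: "C \<subseteq> carrier V" using C by (simp add: basis_def)
  obtain \<kappa> where lin: "\<And>c. c \<in> C \<Longrightarrow> linear_form (\<kappa> c)"
    and dual: "\<And>c d. c \<in> C \<Longrightarrow> d \<in> C \<Longrightarrow> \<kappa> c d = (if c = d then \<one>\<^bsub>K\<^esub> else \<zero>\<^bsub>K\<^esub>)"
    using basis_coordinates[OF C] by auto
  define m where "m = length bs"
  define f where "f i = \<kappa> (bs ! i)" for i
  have bC: "bs ! i \<in> C" if "i < m" for i using that bs(2) by (auto simp: m_def)
  have f: "linear_form (f i)" if "i < m" for i using lin[OF bC[OF that]] by (simp add: f_def)
  have bst: "bs \<in> tuples V m" using bs(2) Cc by (auto simp: tuples_def m_def)
  have fbs: "f i (bs ! j) = (if i = j then \<one>\<^bsub>K\<^esub> else \<zero>\<^bsub>K\<^esub>)" if "i < m" "j < m" for i j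
    using that dual bC bs(1) by (simp add: f_def nth_eq_iff_index_eq m_def)
  \<comment> \<open>The kernel of a coordinate along \<open>bs\<close> is a submodule containing the
    remaining basis vectors, hence their span.\<close>
  have van: "f i v = \<zero>\<^bsub>K\<^esub>" if i: "i < m" and v: "v \<in> span (C - set bs)" for i v
  proof -
    note fi = f[OF i, unfolded linear_form_def]
    have "submodule K {v \<in> carrier V. f i v = \<zero>\<^bsub>K\<^esub>} V"
    proof
      have "f i (\<zero>\<^bsub>K\<^esub> \<odot>\<^bsub>V\<^esub> \<zero>\<^bsub>V\<^esub>) = \<zero>\<^bsub>K\<^esub> \<otimes>\<^bsub>K\<^esub> f i \<zero>\<^bsub>V\<^esub>" "f i \<zero>\<^bsub>V\<^esub> \<in> carrier K"
        using fi R.zero_closed M.zero_closed by blast+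
      then show "\<zero>\<^bsub>V\<^esub> \<in> {v \<in> carrier V. f i v = \<zero>\<^bsub>K\<^esub>}" by simp
    qed (use fi module_axioms in auto)
    moreover have "C - set bs \<subseteq> {v \<in> carrier V. f i v = \<zero>\<^bsub>K\<^esub>}"
      using Cc dual bC[OF i] i by (auto simp: f_def m_def)
    ultimately show ?thesis using span_is_subset v by blast
  qed
  have alt: "alternating_form m (det_form f m)" by (rule alternating_form_det_form[OF f])
  show ?thesis
  proof (rule that[of "det_form f m"])
    show "alternating_form (length bs) (det_form f m)" using alt by (simp add: m_def)
    show "det_form f m bs = \<one>\<^bsub>K\<^esub>" by (rule det_form_dual[OF f bst fbs])
    fix xs c j
    assume xs: "xs \<in> tuples V (length bs)" and D: "det_form f m xs \<noteq> \<zero>\<^bsub>K\<^esub>"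
      and c: "c \<in> {..<length bs} \<rightarrow> carrier K"
      and s: "(\<Oplus>\<^bsub>V\<^esub>j\<in>{..<length bs}. c j \<odot>\<^bsub>V\<^esub> xs ! j) \<in> span (C - set bs)" and j: "j < length bs"
    note xs = xs[folded m_def] and c = c[folded m_def] and s = s[folded m_def] and j = j[folded m_def]
    let ?v = "\<Oplus>\<^bsub>V\<^esub>j\<in>{..<m}. c j \<odot>\<^bsub>V\<^esub> xs ! j"
    have v: "?v \<in> carrier V" by (rule span_closed[OF _ s]) (use Cc in auto)
    have "xs[j := ?v] ! j = ?v" using xs j by (simp add: tuples_def)
    then have "det_form f m (xs[j := ?v]) = \<zero>\<^bsub>K\<^esub>"
      using van[OF _ s] by (intro det_form_zero[OF f update_tuples[OF xs v] j]) simp_all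
    then have "c j \<otimes>\<^bsub>K\<^esub> det_form f m xs = \<zero>\<^bsub>K\<^esub>"
      using alternating_form_dependent[OF alt xs j c] by simp
    moreover have "det_form f m xs \<in> carrier K" by (rule funcset_mem[OF alternating_formD(1)[OF alt] xs])
    moreover have "c j \<in> carrier K" using c j by auto
    ultimately show "c j = \<zero>\<^bsub>K\<^esub>" using integral_iff D by blast
  qed
qed

section \<open>Images of subspaces under linear maps and a criterion for complements\<close>

lemma image_subspace:
  assumes T: "T \<in> module_hom K V V" and W: "subspace K W V"
  shows "subspace K (T ` W) V"
proof (rule submodule_subspace)
  interpret T: mod_hom K V V T by unfold_locales (rule T)
  interpret W: submodule K W V using W by simp
  have Wc: "v \<in> W \<Longrightarrow> v \<in> carrier V" for v using W.subset by auto
  show "submodule K (T ` W) V"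
  proof
    show "\<zero>\<^bsub>V\<^esub> \<in> T ` W" using T.f0_is_0 W.zero_closed by (intro image_eqI[where x = "\<zero>\<^bsub>V\<^esub>"]) simp_all
    fix v w assume "v \<in> T ` W" "w \<in> T ` W"
    then obtain v' w' where "v' \<in> W" "w' \<in> W" "v = T v'" "w = T w'" by auto
    then show "v \<oplus>\<^bsub>V\<^esub> w \<in> T ` W"
      by (intro image_eqI[where x = "v' \<oplus>\<^bsub>V\<^esub> w'"]) (simp_all add: Wc)
  next
    fix c v assume c: "c \<in> carrier K" and "v \<in> T ` W"
    then obtain v' where "v' \<in> W" "v = T v'" by auto
    with c show "c \<odot>\<^bsub>V\<^esub> v \<in> T ` W"
      by (intro image_eqI[where x = "c \<odot>\<^bsub>V\<^esub> v'"]) (simp_all add: Wc)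
  qed (use Wc in auto)
qed

lemma dim_image:
  assumes fd: fin_dim and T: "T \<in> module_hom K V V" "inj_on T (carrier V)" and W: "subspace K W V"
  shows "vectorspace.dim K (vs (T ` W)) = vectorspace.dim K (vs W)"
proof -
  have Wc: "W \<subseteq> carrier V" using W submodule.subset is_module by blast
  have "T \<in> module_hom K (vs W) (vs (T ` W))"
    using T(1) Wc by (auto simp: module_hom_def subset_iff)
  then interpret L: linear_map K "vs W" "vs (T ` W)" T
    using subspace_is_vs[OF W] subspace_is_vs[OF image_subspace[OF T(1) W]]
    by (simp add: linear_map_def mod_hom_def mod_hom_axioms_def vectorspace_def)
  show ?thesis
    using L.dim_eq subspace_fin_dim[OF fd W] inj_on_subset[OF T(2) Wc] by simp
qed

lemma lin_ext_cong:
  assumes "f \<in> carrier (free_space K S)" "D \<in> S \<rightarrow> carrier K" "\<And>s. s \<in> S \<Longrightarrow> D s = E s"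
  shows "lin_ext S D f = lin_ext S E f"
  unfolding lin_ext_def using assms
  by (intro R.finsum_cong') (auto simp: free_space_simps Pi_iff PiE_iff)

lemma finsum_hom:
  assumes T: "T \<in> module_hom K V V" and "finite A" "x \<in> A \<rightarrow> carrier V"
  shows "T (\<Oplus>\<^bsub>V\<^esub>j\<in>A. x j) = (\<Oplus>\<^bsub>V\<^esub>j\<in>A. T (x j))"
proof -
  interpret T: mod_hom K V V T by unfold_locales (rule T)
  show ?thesis using assms(2,3) by (induction A rule: finite_induct) (auto simp: Pi_iff)
qed

text \<open>The dimensions already fit because \<open>T\<close> is injective, so only the
  intersection matters. A vector in the image of \<open>V1\<close> is a combination of the images of
  \<open>xs\<close>, and \<open>sep\<close> makes its coefficients vanish once it lies in
  \<open>V2\<close>.\<close>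

lemma separated_direct_sum:
  assumes fd: fin_dim and T: "T \<in> module_hom K V V" "inj_on T (carrier V)"
    and V1: "subspace K V1 V" and V2: "subspace K V2 V"
    and dims: "vectorspace.dim K (vs V1) + vectorspace.dim K (vs V2) = dim"
    and xs: "distinct xs" "set xs \<subseteq> carrier V" "span (set xs) = V1"
    and sep: "\<And>c j. c \<in> {..<length xs} \<rightarrow> carrier K \<Longrightarrow>
      (\<Oplus>\<^bsub>V\<^esub>j\<in>{..<length xs}. c j \<odot>\<^bsub>V\<^esub> map T xs ! j) \<in> V2 \<Longrightarrow> j < length xs \<Longrightarrow> c j = \<zero>\<^bsub>K\<^esub>"
  shows "is_direct_sum V (T ` V1) V2"
proof -
  interpret T: mod_hom K V V T by unfold_locales (rule T)
  note TV1 = image_subspace[OF T(1) V1]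
  have z: "\<zero>\<^bsub>V\<^esub> \<in> T ` V1" "\<zero>\<^bsub>V\<^esub> \<in> V2"
    using submodule.zero_closed[OF is_module[OF TV1]] submodule.zero_closed[OF is_module[OF V2]] by auto
  have v0: "v = \<zero>\<^bsub>V\<^esub>" if v: "v \<in> T ` V1" "v \<in> V2" for v
  proof -
    obtain u where u: "u \<in> span (set xs)" "v = T u" using v(1) xs(3) by auto
    obtain a where a: "a \<in> set xs \<rightarrow> carrier K" "lincomb a (set xs) = u"
      using finite_in_span[OF finite_set xs(2) u(1)] by auto
    have cl: "a (xs ! j) \<in> carrier K" "xs ! j \<in> carrier V" if "j < length xs" for j
      using a(1) xs(2) that by auto
    have us: "u = (\<Oplus>\<^bsub>V\<^esub>j\<in>{..<length xs}. a (xs ! j) \<odot>\<^bsub>V\<^esub> xs ! j)"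
      using lincomb_list_sum[OF xs(1,2) a(1)] a(2) by simp
    have "T u = (\<Oplus>\<^bsub>V\<^esub>j\<in>{..<length xs}. T (a (xs ! j) \<odot>\<^bsub>V\<^esub> xs ! j))"
      unfolding us by (rule finsum_hom[OF T(1)]) (use cl in auto)
    also have "\<dots> = (\<Oplus>\<^bsub>V\<^esub>j\<in>{..<length xs}. a (xs ! j) \<odot>\<^bsub>V\<^esub> map T xs ! j)"
      using cl by (intro M.finsum_cong') auto
    finally have "a (xs ! j) = \<zero>\<^bsub>K\<^esub>" if "j < length xs" for j
      using sep[of "\<lambda>j. a (xs ! j)" j] that v(2) u(2) cl(1) by simp
    then have "a \<in> set xs \<rightarrow> {\<zero>\<^bsub>K\<^esub>}" by (auto simp: set_conv_nth)
    then have "u = \<zero>\<^bsub>V\<^esub>" using lincomb_zero[OF xs(2)] a(2) by simp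
    then show ?thesis using u(2) by simp
  qed
  have int: "T ` V1 \<inter> V2 = {\<zero>\<^bsub>V\<^esub>}"
  proof (intro equalityI subsetI)
    fix v assume "v \<in> T ` V1 \<inter> V2"
    then have "v = \<zero>\<^bsub>V\<^esub>" by (elim IntE) (rule v0)
    then show "v \<in> {\<zero>\<^bsub>V\<^esub>}" by (simp only: singleton_iff)
  next
    fix v assume "v \<in> {\<zero>\<^bsub>V\<^esub>}"
    then have "v = \<zero>\<^bsub>V\<^esub>" by (rule singletonD)
    then show "v \<in> T ` V1 \<inter> V2" using z by (simp only: Int_iff)
  qed
  have "submodule_sum (T ` V1) V2 = carrier V"
    using complementary_dims[OF fd TV1 V2 int] dim_image[OF fd T V1] dims by simp
  with int show ?thesis by (simp add: is_direct_sum_def)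
qed

subsection \<open>Group representations\<close>

context
  fixes G :: "('g, 'x) monoid_scheme" and \<rho> :: "'g \<Rightarrow> 'c \<Rightarrow> 'c"
  assumes G: "group G" and rep: "\<rho> \<in> hom G (GL K V)"
begin

lemma rep_hom: "g \<in> carrier G \<Longrightarrow> \<rho> g \<in> module_hom K V V"
  and rep_inj: "g \<in> carrier G \<Longrightarrow> inj_on (\<rho> g) (carrier V)"
  and rep_closed: "g \<in> carrier G \<Longrightarrow> v \<in> carrier V \<Longrightarrow> \<rho> g v \<in> carrier V"
proof -
  assume g: "g \<in> carrier G"
  then have "\<rho> g \<in> Bij (carrier V) \<inter> module_hom K V V" using rep by (auto simp: hom_def GL_def)
  then show "\<rho> g \<in> module_hom K V V" "inj_on (\<rho> g) (carrier V)" "v \<in> carrier V \<Longrightarrow> \<rho> g v \<in> carrier V"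
    by (auto simp: Bij_def bij_betw_def module_hom_def)
qed

text \<open>Multiplication in \<open>GL K V\<close> is composition restricted to
  \<open>carrier V\<close>, hence the pointwise form.\<close>

lemma rep_mult:
  assumes "g \<in> carrier G" "h \<in> carrier G" "v \<in> carrier V"
  shows "\<rho> (g \<otimes>\<^bsub>G\<^esub> h) v = \<rho> g (\<rho> h v)"
proof -
  have "\<rho> g \<in> Bij (carrier V)" "\<rho> h \<in> Bij (carrier V)" using rep assms by (auto simp: hom_def GL_def)
  then show ?thesis using rep assms by (simp add: hom_def GL_def BijGroup_def compose_def)
qed

text \<open>Multiplicativity gives idempotence, and injectivity cancels one application.\<close>

lemma rep_one:
  assumes v: "v \<in> carrier V"
  shows "\<rho> \<one>\<^bsub>G\<^esub> v = v"
proof -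
  interpret G: group G by (rule G)
  have "\<rho> \<one>\<^bsub>G\<^esub> (\<rho> \<one>\<^bsub>G\<^esub> v) = \<rho> \<one>\<^bsub>G\<^esub> v"
    using rep_mult[OF G.one_closed G.one_closed v] by simp
  then show ?thesis
    using rep_inj[OF G.one_closed] rep_closed[OF G.one_closed v] v by (simp add: inj_on_eq_iff)
qed

section \<open>Dense implies thick\<close>

lemma m_dense_imp_m_thick:
  assumes fd: fin_dim and m: "m < dim" and dense: "m_dense m K V G \<rho>"
  shows "m_thick m K V G \<rho>"
  unfolding m_thick_def
proof (intro allI impI, elim conjE, rule ccontr)
  fix V1 V2
  assume V1: "subspace K V1 V" and V2: "subspace K V2 V"
    and d1: "subspace_dim K V V1 = m" and d2: "subspace_dim K V V2 = dim - m"
    and no: "\<not> (\<exists>g\<in>carrier G. is_direct_sum V (\<rho> g ` V1) V2)"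
  interpret G: group G by (rule G)
  obtain B1 where B1: "B1 \<subseteq> V1" "finite B1" "lin_indpt B1" "span B1 = V1" "card B1 = m"
    using subspace_basis[OF fd V1] d1 by metis
  obtain B2 where B2: "B2 \<subseteq> V2" "finite B2" "lin_indpt B2" "span B2 = V2" "card B2 = dim - m"
    using subspace_basis[OF fd V2] d2 by metis
  have sub: "V1 \<subseteq> carrier V" "V2 \<subseteq> carrier V"
    using submodule.subset[OF is_module[OF V1]] submodule.subset[OF is_module[OF V2]] by auto
  \<comment> \<open>\<open>C1\<close> will supply a form that detects the basis \<open>xs\<close> of
    \<open>V1\<close>; \<open>C2\<close> supplies both a basis \<open>bs\<close> of a complement of
    \<open>V2\<close> and the determinant modulo \<open>V2\<close>.\<close>
  obtain C1 where C1: "B1 \<subseteq> C1" "finite C1" "basis C1"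
    using extend_to_basis[OF fd _ B1(3)] B1(1) sub by blast
  obtain C2 where C2: "B2 \<subseteq> C2" "finite C2" "basis C2"
    using extend_to_basis[OF fd _ B2(3)] B2(1) sub by blast
  obtain xs where xs: "set xs = B1" "distinct xs" using finite_distinct_list[OF B1(2)] by auto
  obtain bs where bs: "set bs = C2 - B2" "distinct bs"
    using finite_distinct_list[of "C2 - B2"] C2(2) by auto
  have len: "length xs = m" using xs B1(5) distinct_card by force
  have "length bs = card (C2 - B2)" using bs distinct_card by metis
  \<comment> \<open>Since \<open>m < dim\<close>, the truncated subtraction is exact and
    \<open>dim - (dim - m)\<close> is \<open>m\<close>.\<close>
  also have "\<dots> = m" using card_Diff_subset[OF B2(2) C2(1)] dim_basis[OF C2(2,3)] B2(5) m by simp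
  finally have lbs: "length bs = m" .
  have C2c: "C2 \<subseteq> carrier V" using C2(3) by (simp add: basis_def)
  have xt: "xs \<in> tuples V m" and bt: "bs \<in> tuples V m"
    using xs bs B1(1) sub C2c len lbs by (auto simp: tuples_def)
  \<comment> \<open>The form \<open>E\<close> certifies that the class of \<open>xs\<close> in the
    exterior power is nonzero.\<close>
  obtain E where E: "alternating_form m E" "E xs = \<one>\<^bsub>K\<^esub>"
    using exists_separating_form[OF C1(2,3) xs(2)] xs(1) C1(1) len by metis
  have sb: "C2 - set bs = B2" using bs(1) C2(1) by auto
  \<comment> \<open>\<open>D\<close> is the determinant modulo \<open>V2\<close>, because the
    vectors of \<open>C2\<close> outside \<open>bs\<close> are a basis of \<open>V2\<close>.\<close>
  obtain D where D: "alternating_form m D" "D bs = \<one>\<^bsub>K\<^esub>"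
    and sep: "\<And>ys c j. ys \<in> tuples V m \<Longrightarrow> D ys \<noteq> \<zero>\<^bsub>K\<^esub> \<Longrightarrow> c \<in> {..<m} \<rightarrow> carrier K \<Longrightarrow>
      (\<Oplus>\<^bsub>V\<^esub>j\<in>{..<m}. c j \<odot>\<^bsub>V\<^esub> ys ! j) \<in> V2 \<Longrightarrow> j < m \<Longrightarrow> c j = \<zero>\<^bsub>K\<^esub>"
    by (rule exists_separating_form[OF C2(2,3) bs(2)]) (use bs(1) lbs B2(4) sb in auto)
  have tup: "map (\<rho> g) ys \<in> tuples V m" if "g \<in> carrier G" "ys \<in> tuples V m" for g ys
    using that rep_closed by (auto simp: tuples_def)
  \<comment> \<open>By \<open>sep\<close>, a nonzero value would make the translate of
    \<open>V1\<close> a complement of \<open>V2\<close>, against the assumption.\<close>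
  have D0: "D (map (\<rho> g) xs) = \<zero>\<^bsub>K\<^esub>" if g: "g \<in> carrier G" for g
  proof (rule ccontr)
    assume nz: "D (map (\<rho> g) xs) \<noteq> \<zero>\<^bsub>K\<^esub>"
    have "is_direct_sum V (\<rho> g ` V1) V2"
    proof (rule separated_direct_sum[OF fd rep_hom[OF g] rep_inj[OF g] V1 V2])
      show "subspace_dim K V V1 + subspace_dim K V V2 = dim" using d1 d2 m by simp
      show "distinct xs" by (rule xs(2))
      show "set xs \<subseteq> carrier V" unfolding xs(1) using B1(1) sub(1) by (rule subset_trans)
      show "span (set xs) = V1" unfolding xs(1) by (rule B1(4))
    qed (use sep[OF tup[OF g xt] nz] len in simp)
    with no g show False by auto
  qed
  let ?F = "free_space K (tuples V m)"
  interpret F: module K ?F by (rule module_free_space)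
  let ?D = "\<lambda>g. D \<circ> map (\<rho> g)"
  \<comment> \<open>The common kernel of the functionals of all translates of \<open>D\<close>;
    ranging over the whole group makes it invariant.\<close>
  let ?U = "{f \<in> carrier ?F. \<forall>g\<in>carrier G. lin_ext (tuples V m) (?D g) f = \<zero>\<^bsub>K\<^esub>}"
  have alt: "alternating_form m (?D g)" if "g \<in> carrier G" for g
    by (rule alternating_form_comp[OF D(1) rep_hom[OF that]])
  note Dc = alternating_formD(1)[OF alt]
  have U: "submodule K ?U ?F"
    using submodule_lin_ext_ker[OF Dc] unfolding submodule_def by auto
  have NU: "wedge_kernel K V m \<subseteq> ?U"
    using lin_ext_wedge_kernel[OF alt] submodule.subset[OF submodule_wedge_kernel] by auto
  have inv: "free_map K (tuples V m) (map (\<rho> h)) f \<in> ?U" if h: "h \<in> carrier G" and f: "f \<in> ?U" for h f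
  proof -
    have fc: "f \<in> carrier ?F" using f by simp
    have th: "map (\<rho> h) \<in> tuples V m \<rightarrow> tuples V m" using tup[OF h] by auto
    have "lin_ext (tuples V m) (?D g) (free_map K (tuples V m) (map (\<rho> h)) f) = \<zero>\<^bsub>K\<^esub>"
      if g: "g \<in> carrier G" for g
    proof -
      \<comment> \<open>Applying \<open>h\<close> first turns the translate by \<open>g\<close> into
        the translate by the product, which is again among the functionals defining
        \<open>?U\<close>.\<close>
      have gh: "g \<otimes>\<^bsub>G\<^esub> h \<in> carrier G" using g h by simp
      have "lin_ext (tuples V m) (?D g) (free_map K (tuples V m) (map (\<rho> h)) f) =
          lin_ext (tuples V m) (?D g \<circ> map (\<rho> h)) f"
        by (rule lin_ext_free_map[OF th Dc[OF g] fc])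
      also have "\<dots> = lin_ext (tuples V m) (?D (g \<otimes>\<^bsub>G\<^esub> h)) f"
      proof (rule lin_ext_cong[OF fc, symmetric, OF Dc[OF gh]])
        fix ys assume "ys \<in> tuples V m"
        then have "map (\<rho> (g \<otimes>\<^bsub>G\<^esub> h)) ys = map (\<rho> g) (map (\<rho> h) ys)"
          using rep_mult[OF g h] by (auto simp: tuples_def)
        then show "?D (g \<otimes>\<^bsub>G\<^esub> h) ys = (?D g \<circ> map (\<rho> h)) ys" by (simp only: o_apply)
      qed
      also have "\<dots> = \<zero>\<^bsub>K\<^esub>" using f gh by simp
      finally show ?thesis .
    qed
    with free_map_closed[OF th fc] show ?thesis by simp
  qed
  have "?U = wedge_kernel K V m \<or> ?U = carrier ?F"
    using dense unfolding m_dense_def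
    by (rule irreducible_exterior_power_rep[OF _ rep_hom U NU inv])
  then show False
  proof
    \<comment> \<open>Impossible: the generator of \<open>xs\<close> is in \<open>?U\<close>, but
      \<open>E\<close> vanishes on the kernel and not on \<open>xs\<close>.\<close>
    assume "?U = wedge_kernel K V m"
    moreover have "free_gen K (tuples V m) xs \<in> ?U"
      using D0 free_gen_closed[OF xt] lin_ext_free_gen[OF xt Dc] by simp
    ultimately have "lin_ext (tuples V m) E (free_gen K (tuples V m) xs) = \<zero>\<^bsub>K\<^esub>"
      using lin_ext_wedge_kernel[OF E(1)] by simp
    then show False using lin_ext_free_gen[OF xt alternating_formD(1)[OF E(1)]] E(2) by simp
  next
    \<comment> \<open>Impossible: the translate of \<open>D\<close> by the identity has value one on
      \<open>bs\<close>.\<close>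
    assume "?U = carrier ?F"
    then have "free_gen K (tuples V m) bs \<in> ?U" using free_gen_closed[OF bt] by simp
    then have "?D \<one>\<^bsub>G\<^esub> bs = \<zero>\<^bsub>K\<^esub>" using lin_ext_free_gen[OF bt Dc[OF G.one_closed]] by simp
    moreover have "map (\<rho> \<one>\<^bsub>G\<^esub>) bs = bs" using bs(1) C2c rep_one by (intro map_idI) auto
    ultimately show False using D(2) by simp
  qed
qed

section \<open>Thick implies irreducible\<close>

lemma thick_imp_irreducible:
  assumes fd: fin_dim and thick: "thick K V G \<rho>"
  shows "irreducible_rep K V G \<rho>"
  unfolding irreducible_rep_def
proof (intro allI impI, rule ccontr)
  fix W assume "invariant_subspace K V G \<rho> W" and nt: "\<not> (W = {\<zero>\<^bsub>V\<^esub>} \<or> W = carrier V)"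
  then have W: "subspace K W V" and inv: "\<And>g. g \<in> carrier G \<Longrightarrow> \<rho> g ` W \<subseteq> W"
    by (auto simp: invariant_subspace_def)
  have Wc: "W \<subseteq> carrier V" by (rule submodule.subset[OF is_module[OF W]])
  obtain B where B: "B \<subseteq> W" "finite B" "lin_indpt B" "span B = W" "card B = subspace_dim K V W"
    by (rule subspace_basis[OF fd W])
  have Bc: "B \<subseteq> carrier V" using B Wc by auto
  have "B \<noteq> {}" using B(4) nt span_empty by auto
  then have pos: "0 < card B" using B(2) by auto
  have less: "card B < dim"
  proof (rule ccontr)
    assume "\<not> card B < dim"
    then have "basis B" using dim_li_is_basis[OF fd B(2) Bc B(3)] by simp
    then show False using nt B(4) by (simp add: basis_def)
  qed
  obtain C where C: "B \<subseteq> C" "finite C" "basis C" by (rule extend_to_basis[OF fd Bc B(3)])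
  have Cc: "C \<subseteq> carrier V" "lin_indpt C" "card C = dim" using C dim_basis by (auto simp: basis_def)
  \<comment> \<open>Inside the single basis \<open>C\<close>, a set of the complementary size can be
    chosen comparable with \<open>B\<close>: above it if \<open>card B \<le> dim - card B\<close>,
    inside it otherwise.\<close>
  obtain B' where B': "B' \<subseteq> C" "card B' = dim - card B" "B \<subseteq> B' \<or> B' \<subseteq> B"
  proof (cases "card B \<le> dim - card B")
    case True
    then show ?thesis using exists_subset_between[OF True _ C(1,2)] Cc(3) that by auto
  next
    case False
    then show ?thesis using exists_subset_between[of "{}" "dim - card B" B] B(2) C(1) that
      by (metis card.empty empty_subsetI le0 nat_le_linear subset_trans)
  qed
  have fB': "finite B'" and B'c: "B' \<subseteq> carrier V" and iB': "lin_indpt B'"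
    using B'(1) C(2) Cc subset_li_is_li finite_subset by blast+
  have "m_thick (card B) K V G \<rho>" using thick pos less by (simp add: thick_def)
  moreover have "subspace K (span B') V" by (rule span_is_subspace[OF B'c])
  moreover have "subspace_dim K V (span B') = dim - card B" using dim_span[OF fB' B'c iB'] B'(2) by simp
  ultimately obtain g where g: "g \<in> carrier G" and ds: "is_direct_sum V (\<rho> g ` W) (span B')"
    using W B(5) unfolding m_thick_def by auto
  let ?S = "B \<union> B'"
  have Sc: "?S \<subseteq> carrier V" using Bc B'c by auto
  \<comment> \<open>Invariance keeps the translate of \<open>W\<close> inside the span of
    \<open>B\<close>, so the direct sum stays within the span of
    \<open>B \<union> B'\<close>.\<close>
  have "carrier V \<subseteq> span ?S"
  proof
    fix v assume "v \<in> carrier V"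
    then have "v \<in> submodule_sum (\<rho> g ` W) (span B')" using ds by (simp add: is_direct_sum_def)
    then obtain u w where uw: "u \<in> \<rho> g ` W" "w \<in> span B'" "v = u \<oplus>\<^bsub>V\<^esub> w"
      by (auto simp: submodule_sum_def)
    then have "u \<in> span B" using inv[OF g] B(4) by auto
    then have "u \<in> span ?S" "w \<in> span ?S"
      using uw(2) span_is_monotone[of B ?S] span_is_monotone[of B' ?S] by auto
    then show "v \<in> span ?S" unfolding uw(3) by (rule span_add1[OF Sc])
  qed
  then have "span ?S = carrier V" using span_is_subset2[OF Sc] by auto
  then have "dim \<le> card ?S" using gen_ge_dim[OF _ Sc] B(2) fB' by auto
  \<comment> \<open>The union is one of the two sets. \<open>B\<close> has fewer than
    \<open>dim\<close> elements, and so does \<open>B'\<close> because \<open>card B\<close> is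
    positive; neither can span.\<close>
  moreover have "?S = B \<or> ?S = B'" using B'(3) by auto
  ultimately show False using less pos B'(2) by auto
qed

end

end

theorem corollary2p8:
  fixes G :: "('g, 'c) monoid_scheme"
    and K :: "('k, 'a) ring_scheme"
    and V :: "('k, 'v, 'b) module_scheme"
    and \<rho> :: "'g \<Rightarrow> 'v \<Rightarrow> 'v"
  assumes "group G"
    and "vectorspace K V"
    and "vectorspace.fin_dim K V"
    and "\<rho> \<in> hom G (GL K V)"
  shows "(dense K V G \<rho> \<longrightarrow> thick K V G \<rho>) \<and> (thick K V G \<rho> \<longrightarrow> irreducible_rep K V G \<rho>)"
proof -
  interpret vectorspace K V by (rule assms)
  \<comment> \<open>Density in degree \<open>m\<close> gives thickness in the same degree, and both
    notions range over the same \<open>m\<close>.\<close>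
  show ?thesis
    using m_dense_imp_m_thick[OF assms(1,4,3)] thick_imp_irreducible[OF assms(1,4,3)]
    by (auto simp: dense_def thick_def)
qed

end
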